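(* (1) Let $k\geq 1$. There is a one-to-one correspondence between the isomorphism classes (under the action of $G$) of pairs $(C,E)$, where $C$ is an even self-dual $L$-code of length $n$ and $E\subseteq C$ is a subcode which is a copy of $\Delta_k$ (i.e. supported on some $k$ coordinates, where it equals $\Delta_k$, and zero elsewhere), and the equivalence classes of self-dual $L$-codes of length $n-k$. (2) Let $C$ be an even self-dual $L$-code of length $n$ and $[x]$ a nonzero coset in $L^n/C$. Put $C_0=C\cap x^\perp$ (which depends only on $[x]$), choose $y\in[x]$ of odd Euclidean weight, and set $D(C,[x])=C_0\cup(C_0+y)$. This assignment induces a correspondence between $G$-isomorphism classes of such pairs $(C,[x])$ and equivalence classes of non-even self-dual $L$-codes of length $n$, such that for each equivalence class $[D]$ of non-even self-dual codes there are either one or two classes of pairs $[(C,[x])]$ corresponding to it.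
   Context: Let $L=\{0,1,\omega,\bar\omega\}$ be the Klein four-group $\mathbf{Z}_2\times\mathbf{Z}_2$. Define $|0|^2=0$, $|1|^2=1$, $|\omega|^2=|\bar\omega|^2=2$; the dot product $x\cdot y\in\mathbf{F}_2$ is $1$ iff $x,y$ distinct and nonzero. On $L^n$: $(\mathbf{x},\mathbf{y})=\sum_i x_i\cdot y_i$, $\mathrm{ewt}(\mathbf{x})=\sum_i|x_i|^2$, and $x^\perp=\{\mathbf{z}:(\mathbf{z},x)=0\}$. An $L$-code is a subgroup $C\subseteq L^n$; it is self-dual if $C=\{\mathbf{z}:(\mathbf{z},\mathbf{y})=0\ \forall\mathbf{y}\in C\}$, even if all codewords have even Euclidean weight, non-even otherwise. $\Delta_k\subseteq L^k$ is the set of vectors with all coordinates in $\{0,1\}$ and an even number of $1$'s. The group $G=S_2^n{:}S_n$ acts on $L^n$ by permuting coordinates and independently interchanging $\omega,\bar\omega$ in each coordinate; codes (or pairs) in the same orbit are equivalent/isomorphic.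
   Formalization: In (1), k ≤ n is assumed and a copy E of Δ_k is recorded together with its k coordinates; this changes nothing for k ≥ 2, but for k = 1 (E = {0}) the pair marks one coordinate, since the claim for bare pairs (C,{0}) fails, e.g. for n = 3 (4 classes against 5). *)

theory Defs
  imports
    "HOL-Algebra.Group_Action"
    "HOL-Algebra.Product_Groups"
    "HOL-Algebra.Elementary_Groups"
    "HOL-Combinatorics.Permutations"
    "HOL-Library.Z2"
begin

section \<open>The Kleinian four group\<close>

datatype klein = L0 | L1 | Om | OmBar

fun klein_add :: "klein \<Rightarrow> klein \<Rightarrow> klein" where
  "klein_add L0 y = y"
| "klein_add x L0 = x"
| "klein_add L1 L1 = L0"
| "klein_add Om Om = L0"
| "klein_add OmBar OmBar = L0"
| "klein_add L1 Om = OmBar"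
| "klein_add Om L1 = OmBar"
| "klein_add L1 OmBar = Om"
| "klein_add OmBar L1 = Om"
| "klein_add Om OmBar = L1"
| "klein_add OmBar Om = L1"

definition klein_group :: "klein monoid" where
  "klein_group = \<lparr>carrier = UNIV, monoid.mult = klein_add, one = L0\<rparr>"

lemma comm_group_klein: "comm_group klein_group"
proof (rule comm_groupI)
  show "x \<otimes>\<^bsub>klein_group\<^esub> y \<otimes>\<^bsub>klein_group\<^esub> z = x \<otimes>\<^bsub>klein_group\<^esub> (y \<otimes>\<^bsub>klein_group\<^esub> z)" for x y z
    by (cases x; cases y; cases z) (simp_all add: klein_group_def)
  show "x \<otimes>\<^bsub>klein_group\<^esub> y = y \<otimes>\<^bsub>klein_group\<^esub> x" for x y
    by (cases x; cases y) (simp_all add: klein_group_def)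
  show "\<exists>y\<in>carrier klein_group. y \<otimes>\<^bsub>klein_group\<^esub> x = \<one>\<^bsub>klein_group\<^esub>" for x
    by (rule bexI[of _ x]) (cases x; simp add: klein_group_def)+
qed (simp_all add: klein_group_def)

lemma klein_group_iso: "klein_group \<cong> integer_mod_group 2 \<times>\<times> integer_mod_group 2"
proof -
  define h :: "klein \<Rightarrow> int \<times> int" where
    "h = (\<lambda>x. case x of L0 \<Rightarrow> (0, 0) | L1 \<Rightarrow> (1, 1) | Om \<Rightarrow> (1, 0) | OmBar \<Rightarrow> (0, 1))"
  have c: "carrier (integer_mod_group 2 \<times>\<times> integer_mod_group 2) = {0, 1} \<times> {0, 1}"
    by (auto simp: DirProd_def carrier_integer_mod_group)
  have "h (klein_add x y) =
      h x \<otimes>\<^bsub>integer_mod_group 2 \<times>\<times> integer_mod_group 2\<^esub> h y" for x y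
    by (cases x; cases y) (simp_all add: h_def DirProd_def)
  moreover have "h x \<in> {0, 1} \<times> {0, 1}" for x
    by (cases x) (simp_all add: h_def)
  moreover have "bij_betw h UNIV ({0, 1} \<times> {0, 1})"
  proof (rule bij_betw_imageI)
    show "inj h"
      by (rule injI, rename_tac x y, case_tac x; case_tac y) (simp_all add: h_def)
    have "UNIV = {L0, L1, Om, OmBar}"
      using klein.exhaust by blast
    then have "range h = h ` {L0, L1, Om, OmBar}" by (rule arg_cong)
    also have "\<dots> = {0, 1} \<times> {0, 1}" by (auto simp: h_def)
    finally show "range h = {0, 1} \<times> {0, 1}" .
  qed
  ultimately have "h \<in> iso klein_group (integer_mod_group 2 \<times>\<times> integer_mod_group 2)"
    unfolding iso_def hom_def c by (auto simp: klein_group_def c)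
  then show ?thesis by (auto simp: is_iso_def)
qed

fun norm2 :: "klein \<Rightarrow> nat" where
  "norm2 L0 = 0"
| "norm2 L1 = 1"
| "norm2 Om = 2"
| "norm2 OmBar = 2"

definition dot :: "klein \<Rightarrow> klein \<Rightarrow> bit" where
  "dot x y = (if x \<noteq> y \<and> x \<noteq> L0 \<and> y \<noteq> L0 then 1 else 0)"

fun conj_klein :: "klein \<Rightarrow> klein" where
  "conj_klein L0 = L0"
| "conj_klein L1 = L1"
| "conj_klein Om = OmBar"
| "conj_klein OmBar = Om"


section \<open>Codes in \<open>L\<^sup>n\<close>\<close>

text \<open>Vectors are extensional functions on \<open>{..<n}\<close>.\<close>

definition Lpow :: "nat \<Rightarrow> (nat \<Rightarrow> klein) monoid" where
  "Lpow n = product_group {..<n} (\<lambda>_. klein_group)"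

lemma carrier_Lpow: "carrier (Lpow n) = {..<n} \<rightarrow>\<^sub>E UNIV"
  by (simp add: Lpow_def klein_group_def)

lemma comm_group_Lpow: "comm_group (Lpow n)"
proof -
  interpret K: comm_group klein_group by (rule comm_group_klein)
  interpret group "Lpow n" by (simp add: Lpow_def K.is_group)
  show ?thesis
    by (rule group_comm_groupI) (auto simp: Lpow_def fun_eq_iff K.m_comm PiE_iff)
qed

definition ip :: "nat \<Rightarrow> (nat \<Rightarrow> klein) \<Rightarrow> (nat \<Rightarrow> klein) \<Rightarrow> bit" where
  "ip n x y = (\<Sum>i<n. dot (x i) (y i))"

definition ewt :: "nat \<Rightarrow> (nat \<Rightarrow> klein) \<Rightarrow> nat" where
  "ewt n x = (\<Sum>i<n. norm2 (x i))"

definition perp :: "nat \<Rightarrow> (nat \<Rightarrow> klein) \<Rightarrow> (nat \<Rightarrow> klein) set" where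
  "perp n x = {z \<in> carrier (Lpow n). ip n z x = 0}"

type_synonym code = "(nat \<Rightarrow> klein) set"

definition self_dual :: "nat \<Rightarrow> code \<Rightarrow> bool" where
  "self_dual n C \<longleftrightarrow>
     subgroup C (Lpow n) \<and> C = {z \<in> carrier (Lpow n). \<forall>y\<in>C. ip n z y = 0}"

definition even_code :: "nat \<Rightarrow> code \<Rightarrow> bool" where
  "even_code n C \<longleftrightarrow> (\<forall>x\<in>C. even (ewt n x))"


section \<open>The group \<open>G = S\<^sub>2\<^sup>n : S\<^sub>n\<close> and its actions\<close>

text \<open>
  An element \<open>(A, \<pi>)\<close> first moves the entry at coordinate \<open>i\<close> to coordinate \<open>\<pi> i\<close> and then
  interchanges \<open>\<omega>\<close> and its conjugate at the coordinates in \<open>A\<close>; the normal subgroup \<open>S\<^sub>2\<^sup>n\<close> is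
  represented by the subsets of \<open>{..<n}\<close> under symmetric difference.
\<close>

definition GG :: "nat \<Rightarrow> (nat set \<times> (nat \<Rightarrow> nat)) monoid" where
  "GG n = \<lparr>carrier = Pow {..<n} \<times> {\<pi>. \<pi> permutes {..<n}},
           monoid.mult = (\<lambda>(A, \<sigma>) (B, \<tau>). (sym_diff A (\<sigma> ` B), \<sigma> \<circ> \<tau>)),
           one = ({}, id)\<rparr>"

definition vec_act :: "nat \<Rightarrow> nat set \<times> (nat \<Rightarrow> nat) \<Rightarrow> (nat \<Rightarrow> klein) \<Rightarrow> (nat \<Rightarrow> klein)" where
  "vec_act n = (\<lambda>(A, \<pi>). \<lambda>x\<in>carrier (Lpow n). \<lambda>i\<in>{..<n}.
     (if i \<in> A then conj_klein (x (Hilbert_Choice.inv \<pi> i)) else x (Hilbert_Choice.inv \<pi> i)))"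

lemma group_GG: "group (GG n)"
proof (rule groupI)
  fix x y assume "x \<in> carrier (GG n)" "y \<in> carrier (GG n)"
  then obtain A s B t where xy: "x = (A, s)" "y = (B, t)" "A \<subseteq> {..<n}" "B \<subseteq> {..<n}"
    and p: "s permutes {..<n}" "t permutes {..<n}" by (auto simp: GG_def)
  have "s ` B \<subseteq> {..<n}" using xy(4) permutes_image[OF p(1)] by blast
  then show "x \<otimes>\<^bsub>GG n\<^esub> y \<in> carrier (GG n)"
    using xy(3) permutes_compose[OF p(2,1)] by (auto simp: GG_def xy(1,2))
next
  show "\<one>\<^bsub>GG n\<^esub> \<in> carrier (GG n)" by (simp add: GG_def permutes_id)
next
  fix x y z assume "x \<in> carrier (GG n)" "y \<in> carrier (GG n)" "z \<in> carrier (GG n)"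
  then obtain A s B t C u where xyz: "x = (A, s)" "y = (B, t)" "z = (C, u)"
    and p: "s permutes {..<n}" by (auto simp: GG_def)
  have "inj s" using p by (rule permutes_inj)
  then have "s ` (sym_diff B (t ` C)) = sym_diff (s ` B) (s ` t ` C)"
    by (simp add: image_Un image_set_diff)
  then show "x \<otimes>\<^bsub>GG n\<^esub> y \<otimes>\<^bsub>GG n\<^esub> z = x \<otimes>\<^bsub>GG n\<^esub> (y \<otimes>\<^bsub>GG n\<^esub> z)"
    by (auto simp: xyz GG_def image_comp comp_assoc)
next
  fix x assume "x \<in> carrier (GG n)"
  then show "\<one>\<^bsub>GG n\<^esub> \<otimes>\<^bsub>GG n\<^esub> x = x" by (auto simp: GG_def)
next
  fix x assume "x \<in> carrier (GG n)"
  then obtain A s where x: "x = (A, s)" "A \<subseteq> {..<n}" and p: "s permutes {..<n}"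
    by (auto simp: GG_def)
  let ?t = "Hilbert_Choice.inv s"
  have t: "?t permutes {..<n}" using p by (rule permutes_inv)
  have "?t ` A \<subseteq> {..<n}" using x(2) permutes_image[OF t] by blast
  then have "(?t ` A, ?t) \<in> carrier (GG n)" using t by (auto simp: GG_def)
  moreover have "(?t ` A, ?t) \<otimes>\<^bsub>GG n\<^esub> x = \<one>\<^bsub>GG n\<^esub>"
    using permutes_inv_o(2)[OF p] by (simp add: GG_def x)
  ultimately show "\<exists>y\<in>carrier (GG n). y \<otimes>\<^bsub>GG n\<^esub> x = \<one>\<^bsub>GG n\<^esub>" by blast
qed

lemma vec_act_closed: "x \<in> carrier (Lpow n) \<Longrightarrow> vec_act n g x \<in> carrier (Lpow n)"
  by (auto simp: vec_act_def carrier_Lpow split: prod.splits)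

lemma conj_klein_idem [simp]: "conj_klein (conj_klein a) = a"
  by (cases a) simp_all

lemma vec_act_apply:
  "x \<in> carrier (Lpow n) \<Longrightarrow> vec_act n (A, \<pi>) x = (\<lambda>i\<in>{..<n}.
     if i \<in> A then conj_klein (x (Hilbert_Choice.inv \<pi> i)) else x (Hilbert_Choice.inv \<pi> i))"
  by (simp add: vec_act_def)

lemma vec_act_mult:
  assumes "g \<in> carrier (GG n)" "h \<in> carrier (GG n)" "x \<in> carrier (Lpow n)"
  shows "vec_act n (g \<otimes>\<^bsub>GG n\<^esub> h) x = vec_act n g (vec_act n h x)"
proof -
  obtain A s B t where gh: "g = (A, s)" "h = (B, t)"
    and p: "s permutes {..<n}" "t permutes {..<n}" using assms by (auto simp: GG_def)
  have 1: "Hilbert_Choice.inv (s \<circ> t) i = Hilbert_Choice.inv t (Hilbert_Choice.inv s i)" for i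
    using p by (simp add: o_inv_distrib permutes_bij)
  have 2: "i \<in> s ` B \<longleftrightarrow> Hilbert_Choice.inv s i \<in> B" for i
    using p(1) by (metis image_iff permutes_inverses)
  have 3: "Hilbert_Choice.inv s i < n" if "i < n" for i
    using permutes_in_image[OF permutes_inv[OF p(1)], of i] that by simp
  have "vec_act n (A, s) (vec_act n (B, t) x) = (\<lambda>i\<in>{..<n}.
      if i \<in> A then conj_klein (vec_act n (B, t) x (Hilbert_Choice.inv s i))
      else vec_act n (B, t) x (Hilbert_Choice.inv s i))"
    by (rule vec_act_apply[OF vec_act_closed[OF assms(3)]])
  also have "\<dots> = vec_act n ((A, s) \<otimes>\<^bsub>GG n\<^esub> (B, t)) x"
    unfolding GG_def monoid.simps prod.case vec_act_apply[OF assms(3)]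
    by (rule restrict_ext) (auto simp: 1 2 3)
  finally show ?thesis by (simp add: gh)
qed

lemma vec_act_one: "x \<in> carrier (Lpow n) \<Longrightarrow> vec_act n \<one>\<^bsub>GG n\<^esub> x = x"
  by (auto simp: vec_act_def GG_def carrier_Lpow fun_eq_iff PiE_iff extensional_def)

lemma group_action_vec_act: "group_action (GG n) (carrier (Lpow n)) (vec_act n)"
proof -
  interpret group "GG n" by (rule group_GG)
  have inv: "vec_act n (inv\<^bsub>GG n\<^esub> g) (vec_act n g x) = x"
    "vec_act n g (vec_act n (inv\<^bsub>GG n\<^esub> g) x) = x"
    if "g \<in> carrier (GG n)" "x \<in> carrier (Lpow n)" for g x
    using that by (simp_all flip: vec_act_mult add: vec_act_one)
  have Bij: "vec_act n g \<in> Bij (carrier (Lpow n))" if "g \<in> carrier (GG n)" for g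
  proof -
    have "bij_betw (vec_act n g) (carrier (Lpow n)) (carrier (Lpow n))"
      by (rule bij_betwI[where g = "vec_act n (inv\<^bsub>GG n\<^esub> g)"])
         (use that inv vec_act_closed in auto)
    moreover have "vec_act n g \<in> extensional (carrier (Lpow n))"
      by (simp add: vec_act_def split: prod.splits)
    ultimately show ?thesis by (simp add: Bij_def)
  qed
  show ?thesis
    unfolding group_action_def group_hom_def group_hom_axioms_def
  proof (intro conjI group_GG group_BijGroup homI)
    show "vec_act n g \<in> carrier (BijGroup (carrier (Lpow n)))" if "g \<in> carrier (GG n)" for g
      using Bij[OF that] by (simp add: BijGroup_def)
    show "vec_act n (g \<otimes>\<^bsub>GG n\<^esub> h) = vec_act n g \<otimes>\<^bsub>BijGroup (carrier (Lpow n))\<^esub> vec_act n h"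
      if "g \<in> carrier (GG n)" "h \<in> carrier (GG n)" for g h
    proof -
      have "vec_act n (g \<otimes>\<^bsub>GG n\<^esub> h) = compose (carrier (Lpow n)) (vec_act n g) (vec_act n h)"
        using vec_act_mult[OF that] Bij[OF m_closed[OF that]]
        by (auto simp: compose_def fun_eq_iff Bij_def extensional_def)
      then show ?thesis using Bij[OF that(1)] Bij[OF that(2)] by (simp add: BijGroup_def)
    qed
  qed
qed

definition code_act :: "nat \<Rightarrow> nat set \<times> (nat \<Rightarrow> nat) \<Rightarrow> code \<Rightarrow> code" where
  "code_act n g C = vec_act n g ` C"

definition code_classes :: "nat \<Rightarrow> code set \<Rightarrow> code set set" where
  "code_classes n K = orbits (GG n) K (code_act n)"


section \<open>Pairs \<open>(C, E)\<close> with \<open>E\<close> a copy of \<open>\<Delta>\<^sub>k\<close>\<close>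

definition Delta :: "nat \<Rightarrow> code" where
  "Delta k = {x \<in> carrier (Lpow k). (\<forall>i<k. x i \<in> {L0, L1}) \<and> even (card {i. i < k \<and> x i = L1})}"

definition delta_copy :: "nat \<Rightarrow> nat \<Rightarrow> nat set \<Rightarrow> code \<Rightarrow> bool" where
  "delta_copy n k S E \<longleftrightarrow>
     S \<subseteq> {..<n} \<and>
     (\<exists>f. bij_betw f {..<k} S \<and>
        E = {x \<in> carrier (Lpow n).
               (\<forall>i\<in>{..<n} - S. x i = L0) \<and> (\<lambda>j\<in>{..<k}. x (f j)) \<in> Delta k})"

text \<open>
  A copy of \<open>\<Delta>\<^sub>k\<close> carries the set \<open>S\<close> of the \<open>k\<close> coordinates it is placed on. For \<open>k \<ge> 2\<close> the
  set \<open>S\<close> can be read off from \<open>E\<close> (lemma \<open>delta_copy_support\<close>), so recording it changes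
  nothing. It matters for \<open>k = 1\<close> only: \<open>\<Delta>\<^sub>1 = {0}\<close>, and a copy of \<open>\<Delta>\<^sub>1\<close> amounts to the
  choice of one coordinate. (Without it the pairs would just be the codes \<open>C\<close>, and the
  correspondence would fail, e.g. for \<open>n = 3\<close>.)
\<close>

definition delta_pairs :: "nat \<Rightarrow> nat \<Rightarrow> (code \<times> nat set \<times> code) set" where
  "delta_pairs n k = {(C, S, E). self_dual n C \<and> even_code n C \<and> delta_copy n k S E \<and> E \<subseteq> C}"

definition delta_pair_act ::
    "nat \<Rightarrow> nat set \<times> (nat \<Rightarrow> nat) \<Rightarrow> code \<times> nat set \<times> code \<Rightarrow> code \<times> nat set \<times> code" where
  "delta_pair_act n = (\<lambda>g (C, S, E). (code_act n g C, snd g ` S, code_act n g E))"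

definition delta_pair_classes :: "nat \<Rightarrow> nat \<Rightarrow> (code \<times> nat set \<times> code) set set" where
  "delta_pair_classes n k = orbits (GG n) (delta_pairs n k) (delta_pair_act n)"

lemma delta_copy_support:
  assumes E: "delta_copy n k S E" and k: "2 \<le> k"
  shows "S = {i. i < n \<and> (\<exists>x\<in>E. x i \<noteq> L0)}"
proof -
  obtain f where S: "S \<subseteq> {..<n}" and f: "bij_betw f {..<k} S" and Eq:
    "E = {x \<in> carrier (Lpow n). (\<forall>i\<in>{..<n} - S. x i = L0) \<and> (\<lambda>j\<in>{..<k}. x (f j)) \<in> Delta k}"
    using E unfolding delta_copy_def by blast
  have "\<exists>x\<in>E. x i \<noteq> L0" if "i \<in> S" for i
  proof -
    have "i \<in> f ` {..<k}"
      using bij_betw_imp_surj_on[OF f] that by (rule ssubst)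
    then obtain a where a: "a < k" "f a = i"
      unfolding image_iff lessThan_iff Bex_def by (elim exE conjE) simp
    define b :: nat where "b = (if a = 0 then 1 else 0)"
    have b: "b < k" "b \<noteq> a"
      using k by (auto simp: b_def)
    define x where "x = (\<lambda>j\<in>{..<n}. if j = f a \<or> j = f b then L1 else L0)"
    have inS: "f j \<in> S" if "j < k" for j using f that by (auto simp: bij_betw_def)
    have fn: "f j < n" if "j < k" for j using inS[OF that] S by auto
    have xf: "x (f j) = (if j = a \<or> j = b then L1 else L0)" if "j < k" for j
      using f that a b fn[OF that] by (auto simp: x_def bij_betw_def inj_on_def)
    have "{j. j < k \<and> (\<lambda>j\<in>{..<k}. x (f j)) j = L1} = {a, b}"
      using a b by (auto simp: xf split: if_splits)
    then have "(\<lambda>j\<in>{..<k}. x (f j)) \<in> Delta k"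
      using b(2) by (auto simp: Delta_def carrier_Lpow xf)
    moreover have "\<forall>i\<in>{..<n} - S. x i = L0" using inS a b by (auto simp: x_def)
    moreover have "x \<in> carrier (Lpow n)" by (simp add: x_def carrier_Lpow)
    ultimately have "x \<in> E" using Eq by blast
    moreover have "x i \<noteq> L0" using xf[OF a(1)] a(2) by simp
    ultimately show ?thesis by blast
  qed
  then show ?thesis using S Eq by blast
qed


section \<open>Pairs \<open>(C, [x])\<close> with \<open>[x]\<close> a nonzero coset of \<open>C\<close>\<close>

definition coset_pairs :: "nat \<Rightarrow> (code \<times> code) set" where
  "coset_pairs n = {(C, X). self_dual n C \<and> even_code n C \<and>
     X \<in> carrier (Lpow n Mod C) \<and> X \<noteq> \<one>\<^bsub>Lpow n Mod C\<^esub>}"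

definition coset_pair_act ::
    "nat \<Rightarrow> nat set \<times> (nat \<Rightarrow> nat) \<Rightarrow> code \<times> code \<Rightarrow> code \<times> code" where
  "coset_pair_act n = (\<lambda>g (C, X). (code_act n g C, code_act n g X))"

definition coset_pair_classes :: "nat \<Rightarrow> (code \<times> code) set set" where
  "coset_pair_classes n = orbits (GG n) (coset_pairs n) (coset_pair_act n)"

text \<open>The code \<open>D(C, [x])\<close>, computed from representatives \<open>x\<close> and \<open>y\<close> of the coset.\<close>

definition D_code :: "nat \<Rightarrow> code \<Rightarrow> (nat \<Rightarrow> klein) \<Rightarrow> (nat \<Rightarrow> klein) \<Rightarrow> code" where
  "D_code n C x y = (let C0 = C \<inter> perp n x in C0 \<union> (C0 #>\<^bsub>Lpow n\<^esub> y))"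

end

theory Submission
  imports Defs
begin

text \<open>
  On \<open>L\<^sup>n\<close> the Euclidean weight modulo 2 is a quadratic form over the field with two elements whose
  polar form is the inner product; self-dual codes are its Lagrangian subgroups and even self-dual
  codes the totally singular ones. Let \<open>D\<close> be self-dual and non-even with even part \<open>D\<^sub>0\<close>. The
  Gauss sum of the form is positive (\<open>2\<^sup>n\<close>), and it can be evaluated on the orthogonal space of \<open>D\<^sub>0\<close>;
  hence \<open>D\<^sub>0\<close> lies in an even self-dual code, and it lies in at most two. For odd \<open>d \<in> D\<close> the pairs
  \<open>(C, [x])\<close> over \<open>D\<close> are exactly \<open>(C, C + d)\<close> with \<open>C\<close> such a code, which gives (2).

  For (1), move the \<open>k\<close> coordinates of the copy of \<open>\<Delta>\<^sub>k\<close> to the end. A self-dual code of length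
  \<open>m = n - k\<close>, extended by arbitrary binary words on the last \<open>k\<close> coordinates, is self-dual and
  non-even of length \<open>n\<close>; the pairs above it are the even self-dual codes containing its even part.
  There are two of them, exchanged by the conjugation at coordinate \<open>m\<close>.
\<close>

section \<open>Lagrangian subgroups of a quadratic space\<close>

text \<open>For an odd Lagrangian \<open>D\<close> with singular part D0 and an odd \<open>d\<close>
  in it, everything happens in the orthogonal space of D0 modulo D0. It is a plane with four
  classes: zero, \<open>d\<close>, \<open>e\<close> and \<open>e + d\<close>. Since
  \<open>q d = 1\<close> and \<open>B e d = 1\<close>, the last two have the same value of
  \<open>q\<close>, so \<open>D\<close> has either two singular neighbours or none; the second case
  does occur, for an anisotropic plane. The sign of the Gauss sum separates the cases: 1 - 1 + 1 + 1
  against 1 - 1 - 1 - 1. It is positive on the space of words because the norms 0, 1, 2, 2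
  contribute the factor 1 - 1 + 1 + 1 at each coordinate. The two neighbours of \<open>D\<close>
  give inequivalent pairs unless an element of the stabiliser of \<open>D\<close> exchanges them;
  this is the alternative between two classes and one in (2). In (1) such an element always exists,
  because a coordinate outside the shorter code is available for it. This is where
  \<open>1 \<le> k\<close> enters.\<close>

lemma bit_add_self: "a + a = (0 :: bit)"
  by (cases a) simp_all

text \<open>A quadratic space over the field with two elements, written as a group of exponent two.
  The last assumption carries the type of the form: it excludes the elliptic spaces, in which an odd
  Lagrangian subgroup may have no singular neighbour.\<close>

locale binary_quadratic_space = comm_group G for G (structure) +
  fixes B :: "'a \<Rightarrow> 'a \<Rightarrow> bit" and q :: "'a \<Rightarrow> bit"
  assumes mult_self: "x \<in> carrier G \<Longrightarrow> x \<otimes> x = \<one>"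
    and B_mult_left: "\<lbrakk>x \<in> carrier G; y \<in> carrier G; z \<in> carrier G\<rbrakk> \<Longrightarrow> B (x \<otimes> y) z = B x z + B y z"
    and q_mult: "\<lbrakk>x \<in> carrier G; y \<in> carrier G\<rbrakk> \<Longrightarrow> q (x \<otimes> y) = q x + q y + B x y"
    and finite_carrier: "finite (carrier G)"
    and gauss_sum_pos: "0 < (\<Sum>z\<in>carrier G. (if q z = 0 then 1 else -1 :: int))"
begin

definition lagrangian :: "'a set \<Rightarrow> bool" where
  "lagrangian C \<longleftrightarrow> C = {z \<in> carrier G. \<forall>y\<in>C. B z y = 0}"

definition singular :: "'a set \<Rightarrow> bool" where
  "singular C \<longleftrightarrow> (\<forall>x\<in>C. q x = 0)"

text \<open>The code D(C,[x]) with both choices removed: orthogonality is asked for the whole coset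
  \<open>X\<close>, and the translate by an odd representative is replaced by the set of all odd
  elements of \<open>X\<close>.\<close>

definition odd_neighbour :: "'a set \<Rightarrow> 'a set \<Rightarrow> 'a set" where
  "odd_neighbour C X = {z \<in> C. \<forall>x\<in>X. B z x = 0} \<union> {z \<in> X. q z = 1}"

lemma B_sym: "x \<in> carrier G \<Longrightarrow> y \<in> carrier G \<Longrightarrow> B x y = B y x"
  using q_mult[of x y] q_mult[of y x] m_comm[of x y]
  by (cases "q x"; cases "q y"; cases "B x y"; cases "B y x") simp_all

lemma B_mult_right:
  "\<lbrakk>x \<in> carrier G; y \<in> carrier G; z \<in> carrier G\<rbrakk> \<Longrightarrow> B z (x \<otimes> y) = B z x + B z y"
  by (simp add: B_mult_left B_sym[of z])

lemma B_one: "z \<in> carrier G \<Longrightarrow> B \<one> z = 0"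
  using B_mult_left[of \<one> \<one> z] by (simp add: bit_add_self)

lemma q_one: "q \<one> = 0"
  using q_mult[of \<one> \<one>] by (simp add: B_one bit_add_self)

lemma B_self: "x \<in> carrier G \<Longrightarrow> B x x = 0"
  using q_mult[of x x] by (simp add: mult_self q_one bit_add_self)

lemma mult_cancel: "x \<in> carrier G \<Longrightarrow> y \<in> carrier G \<Longrightarrow> x \<otimes> (x \<otimes> y) = y"
  by (simp add: mult_self flip: m_assoc)

lemma mult_cancel_right: "x \<in> carrier G \<Longrightarrow> y \<in> carrier G \<Longrightarrow> x \<otimes> y \<otimes> y = x"
  by (simp add: mult_self m_assoc)

lemma inv_eq_self: "x \<in> carrier G \<Longrightarrow> inv x = x"
  by (rule inv_equality) (simp_all add: mult_self)

lemma subgroup_mult_iff: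
  assumes "subgroup H G" "x \<in> H" "y \<in> carrier G"
  shows "x \<otimes> y \<in> H \<longleftrightarrow> y \<in> H"
  using assms by (metis mult_cancel subgroup.m_closed subgroup.mem_carrier)

lemma r_coset_iff:
  assumes "subgroup H G" "a \<in> carrier G"
  shows "z \<in> H #> a \<longleftrightarrow> z \<in> carrier G \<and> z \<otimes> a \<in> H"
proof
  assume "z \<in> H #> a"
  then obtain h where "h \<in> H" "z = h \<otimes> a" by (auto simp: r_coset_def)
  then show "z \<in> carrier G \<and> z \<otimes> a \<in> H"
    using assms by (simp add: mult_cancel_right subgroup.mem_carrier[OF assms(1)])
next
  assume z: "z \<in> carrier G \<and> z \<otimes> a \<in> H"
  then have "z = (z \<otimes> a) \<otimes> a" using assms by (simp add: mult_cancel_right)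
  with z show "z \<in> H #> a" unfolding r_coset_def by blast
qed

lemma subgroup_orthogonal:
  assumes "S \<subseteq> carrier G"
  shows "subgroup {z \<in> carrier G. \<forall>y\<in>S. B z y = 0} G"
proof (rule subgroupI)
  show "{z \<in> carrier G. \<forall>y\<in>S. B z y = 0} \<noteq> {}"
    using assms by (auto intro!: exI[of _ \<one>] simp: B_one subset_eq)
  show "a \<otimes> b \<in> {z \<in> carrier G. \<forall>y\<in>S. B z y = 0}"
    if "a \<in> {z \<in> carrier G. \<forall>y\<in>S. B z y = 0}" "b \<in> {z \<in> carrier G. \<forall>y\<in>S. B z y = 0}" for a b
    using that assms by (auto simp: B_mult_left subset_eq)
qed (auto simp: inv_eq_self)

lemma lagrangian_carrier: "lagrangian C \<Longrightarrow> x \<in> C \<Longrightarrow> x \<in> carrier G"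
  unfolding lagrangian_def by blast

lemma lagrangian_B: "lagrangian C \<Longrightarrow> x \<in> C \<Longrightarrow> y \<in> C \<Longrightarrow> B x y = 0"
  unfolding lagrangian_def by blast

lemma lagrangianD: "lagrangian C \<Longrightarrow> z \<in> carrier G \<Longrightarrow> (\<And>y. y \<in> C \<Longrightarrow> B z y = 0) \<Longrightarrow> z \<in> C"
  unfolding lagrangian_def by blast

lemma lagrangian_subgroup: "lagrangian C \<Longrightarrow> subgroup C G"
  using subgroup_orthogonal[of C] lagrangian_carrier unfolding lagrangian_def by auto

lemma lagrangian_subset_eq: "lagrangian C \<Longrightarrow> lagrangian D \<Longrightarrow> C \<subseteq> D \<Longrightarrow> C = D"
  unfolding lagrangian_def by blast

section \<open>The odd neighbour of a singular Lagrangian subgroup and a nonzero coset\<close>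

context
  fixes C a
  assumes C: "lagrangian C" and sing: "singular C" and a: "a \<in> carrier G" "a \<notin> C"
begin

interpretation C: subgroup C G
  by (rule lagrangian_subgroup[OF C])

lemma coset_carrier: "x \<in> C #> a \<Longrightarrow> x \<in> carrier G"
  using a by (auto simp: r_coset_iff C.subgroup_axioms)

text \<open>Two elements of the coset differ by an element of \<open>C\<close>, which is orthogonal
  to \<open>c\<close>.\<close>

lemma coset_orthogonal_eq:
  assumes "c \<in> C" "x \<in> C #> a" "x' \<in> C #> a"
  shows "B c x = B c x'"
proof -
  have "B c y = B c a" if "y \<in> C #> a" for y
  proof -
    have "B c (y \<otimes> a) = 0" using that assms(1) a lagrangian_B[OF C]
      by (simp add: r_coset_iff C.subgroup_axioms)
    then show ?thesis using that assms(1) a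
      by (cases "B c y"; cases "B c a") (simp_all add: B_mult_right r_coset_iff C.subgroup_axioms)
  qed
  then show ?thesis using assms by simp
qed

text \<open>As \<open>a\<close> lies outside the Lagrangian \<open>C\<close>, some \<open>c\<close>
  in \<open>C\<close> has \<open>B a c = 1\<close>; adding this singular \<open>c\<close> flips the
  value of \<open>q\<close> at \<open>a\<close>.\<close>

lemma coset_odd: "\<exists>y\<in>C #> a. q y = 1"
proof -
  obtain c where c: "c \<in> C" "B a c = 1"
    using lagrangianD[OF C a(1)] a(2) by (metis bit_not_zero_iff)
  have "q (c \<otimes> a) = q a + 1" using c sing a
    by (simp add: q_mult singular_def B_sym[of c])
  moreover have "c \<otimes> a \<in> C #> a" "\<one> \<otimes> a \<in> C #> a"
    using c C.one_closed unfolding r_coset_def by blast+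
  ultimately show ?thesis using a by (cases "q a") (auto intro: bexI)
qed

text \<open>For \<open>z\<close> in the coset, \<open>z \<otimes> y\<close> is singular, so
  polarisation with \<open>q y = 1\<close> gives \<open>q z = 1 + B z y\<close>, and
  \<open>B z y = B (z \<otimes> y) y\<close> because \<open>B\<close> is alternating. Hence the odd
  elements of the coset are the translate by \<open>y\<close> of the part of \<open>C\<close>
  orthogonal to \<open>y\<close>.\<close>

lemma coset_diff_iff:
  assumes "y \<in> C #> a" "q y = 1" "z \<in> carrier G"
  shows "z \<in> C #> a \<and> q z = 1 \<longleftrightarrow> z \<otimes> y \<in> C \<and> B (z \<otimes> y) y = 0"
proof -
  have y: "y \<in> carrier G" "y \<otimes> a \<in> C" using assms a by (simp_all add: r_coset_iff C.subgroup_axioms)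
  have *: "z \<otimes> y = z \<otimes> a \<otimes> (y \<otimes> a)" using y a assms(3)
    by (metis m_assoc m_comm m_closed mult_cancel_right)
  have "z \<otimes> a \<in> C \<longleftrightarrow> z \<otimes> y \<in> C" using subgroup_mult_iff[OF C.subgroup_axioms y(2), of "z \<otimes> a"] a assms(3) y
    by (simp add: * m_comm)
  moreover have "q z = 1 \<longleftrightarrow> B (z \<otimes> y) y = 0" if "z \<otimes> y \<in> C"
  proof -
    have "q (z \<otimes> y) = 0" using that sing by (simp add: singular_def)
    moreover have "B (z \<otimes> y) y = B z y" using y assms(3) by (simp add: B_mult_left B_self)
    ultimately show ?thesis using y assms by (cases "q z"; cases "B z y") (simp_all add: q_mult)
  qed
  ultimately show ?thesis using assms a by (auto simp: r_coset_iff C.subgroup_axioms)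
qed

lemma odd_neighbour_eq:
  assumes "x \<in> C #> a" "y \<in> C #> a" "q y = 1"
  shows "odd_neighbour C (C #> a) =
    (C \<inter> {z \<in> carrier G. B z x = 0}) \<union> ((C \<inter> {z \<in> carrier G. B z x = 0}) #> y)"
proof -
  have 1: "B z x' = 0 \<longleftrightarrow> B z x = 0" if "z \<in> C" "x' \<in> C #> a" for z x'
    using coset_orthogonal_eq[OF that(1) assms(1) that(2)] by simp
  have y: "y \<in> carrier G" by (rule coset_carrier[OF assms(2)])
  have 2: "{z \<in> C #> a. q z = 1} = (C \<inter> {z \<in> carrier G. B z x = 0}) #> y"
  proof (intro equalityI subsetI)
    fix z assume z: "z \<in> {z \<in> C #> a. q z = 1}"
    then have zc: "z \<in> carrier G" using coset_carrier by blast
    then have "z \<otimes> y \<in> C" "B (z \<otimes> y) x = 0"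
      using z coset_diff_iff[OF assms(2,3) zc] 1[OF _ assms(2)] by auto
    moreover have "z = (z \<otimes> y) \<otimes> y" using y zc by (simp add: mult_cancel_right)
    ultimately show "z \<in> (C \<inter> {z \<in> carrier G. B z x = 0}) #> y"
      using y zc unfolding r_coset_def by auto
  next
    fix z assume "z \<in> (C \<inter> {z \<in> carrier G. B z x = 0}) #> y"
    then obtain c where c: "c \<in> C" "B c x = 0" "z = c \<otimes> y" by (auto simp: r_coset_def)
    then show "z \<in> {z \<in> C #> a. q z = 1}"
      using coset_diff_iff[OF assms(2,3), of z] y 1[OF c(1) assms(2)]
      by (simp add: mult_cancel_right)
  qed
  have "{z \<in> C. \<forall>x\<in>C #> a. B z x = 0} = C \<inter> {z \<in> carrier G. B z x = 0}"
    using 1 assms(1) C.subset by blast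
  then show ?thesis unfolding odd_neighbour_def 2 by simp
qed

lemma odd_neighbour_not_singular: "\<not> singular (odd_neighbour C (C #> a))"
  using coset_odd by (auto simp: singular_def odd_neighbour_def)

text \<open>The neighbour is the part orthogonal to \<open>y\<close> of the group generated by
  \<open>C\<close> and \<open>y\<close>. It contains only half of \<open>C\<close>; the other half
  is the translate by any \<open>c\<close> in \<open>C\<close> with \<open>B c y = 1\<close>. So an
  element orthogonal to the neighbour and to this one \<open>c\<close> is orthogonal to all of
  \<open>C\<close>.\<close>

lemma odd_neighbour_lagrangian: "lagrangian (odd_neighbour C (C #> a))"
proof -
  obtain y where y: "y \<in> C #> a" "q y = 1" using coset_odd by blast
  then have yc: "y \<in> carrier G" by (simp add: coset_carrier)
  let ?D = "odd_neighbour C (C #> a)"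
  have D: "z \<in> ?D \<longleftrightarrow> z \<in> carrier G \<and> B z y = 0 \<and> (z \<in> C \<or> z \<otimes> y \<in> C)" for z
  proof -
    have "(\<forall>x\<in>C #> a. B z x = 0) \<longleftrightarrow> B z y = 0" if "z \<in> C"
      using coset_orthogonal_eq[OF that _ y(1)] y(1) by metis
    then have "z \<in> ?D \<longleftrightarrow> z \<in> C \<and> B z y = 0 \<or> z \<in> C #> a \<and> q z = 1"
      unfolding odd_neighbour_def by blast
    then show ?thesis using coset_diff_iff[OF y, of z] yc coset_carrier C.mem_carrier
      by (auto simp: B_mult_left B_self)
  qed
  obtain c where c: "c \<in> C" "B c y = 1"
  proof -
    have "y \<notin> C" using y sing by (auto simp: singular_def)
    then show ?thesis using lagrangianD[OF C yc] that C.mem_carrier yc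
      by (metis B_sym bit_not_zero_iff)
  qed
  have "z \<in> ?D \<longleftrightarrow> (\<forall>w\<in>?D. B z w = 0)" if z: "z \<in> carrier G" for z
  proof
    assume "z \<in> ?D"
    show "\<forall>w\<in>?D. B z w = 0"
    proof
      fix w assume "w \<in> ?D"
      have *: "\<exists>c\<in>C. v = c \<or> v = c \<otimes> y" if "v \<in> ?D" for v
        using that yc unfolding D by (metis mult_cancel_right)
      obtain c where c: "c \<in> C" "z = c \<or> z = c \<otimes> y" using *[OF \<open>z \<in> ?D\<close>] by blast
      obtain d where d: "d \<in> C" "w = d \<or> w = d \<otimes> y" using *[OF \<open>w \<in> ?D\<close>] by blast
      have cd: "c \<in> carrier G" "d \<in> carrier G" using c d by auto
      have "B c y = 0" "B d y = 0"
        using \<open>z \<in> ?D\<close> \<open>w \<in> ?D\<close> c(2) d(2) cd yc by (auto simp: D B_mult_left B_self)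
      moreover have "B c d = 0" using c d lagrangian_B[OF C] by blast
      ultimately show "B z w = 0"
        using c(2) d(2) cd yc by (auto simp: B_mult_left B_mult_right B_self B_sym[of y d])
    qed
  next
    assume orth: "\<forall>w\<in>?D. B z w = 0"
    have "y \<in> ?D" using yc C.one_closed by (simp add: D B_self mult_self)
    then have zy: "B z y = 0" using orth by blast
    have "B v c' = 0"
      if v: "v \<in> carrier G" "B v y = 0" "\<forall>w\<in>?D. B v w = 0" "B v c = 0" and c': "c' \<in> C" for v c'
    proof (cases "B c' y = 0")
      case True
      then show ?thesis using v c' by (simp add: D)
    next
      case False
      then have "c \<otimes> c' \<in> ?D" using c c' yc by (simp add: D B_mult_left)
      then have "B v (c \<otimes> c') = 0" using v by blast
      then show ?thesis using v c c' by (simp add: B_mult_right)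
    qed
    then have *: "v \<in> C" if "v \<in> carrier G" "B v y = 0" "\<forall>w\<in>?D. B v w = 0" "B v c = 0" for v
      using that lagrangianD[OF C] by blast
    show "z \<in> ?D"
    proof (cases "B z c = 0")
      case True
      then show ?thesis using * z zy orth by (auto simp: D)
    next
      case False
      \<comment> \<open>Adding \<open>y\<close> keeps the orthogonality to the neighbour and changes
        the pairing with \<open>c\<close> by \<open>B y c = 1\<close>, which leads back to the first
        case.\<close>
      have "B y w = 0" if "w \<in> ?D" for w using that yc by (simp add: D B_sym[of y w])
      then have "z \<otimes> y \<in> C" using False z yc zy orth c
        by (intro *) (auto simp: B_mult_left B_self B_sym[of y c] D)
      then show ?thesis using z zy by (simp add: D)
    qed
  qed
  moreover have "?D \<subseteq> carrier G" by (auto simp: D)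
  ultimately show ?thesis unfolding lagrangian_def by blast
qed

end

text \<open>Translation by a singular \<open>d\<close> in \<open>S\<close> multiplies the summand at
  \<open>z\<close> by the sign of \<open>B z d\<close> without changing the sum. Averaging over
  \<open>S\<close> therefore weights \<open>z\<close> by a character sum, which vanishes unless
  \<open>z\<close> is orthogonal to \<open>S\<close>.\<close>

lemma gauss_sum_orthogonal:
  assumes S: "subgroup S G" "singular S"
  shows "(\<Sum>z\<in>carrier G. if q z = 0 then 1 else -1 :: int) =
    (\<Sum>z\<in>{z \<in> carrier G. \<forall>y\<in>S. B z y = 0}. if q z = 0 then 1 else -1)"
proof -
  define s :: "bit \<Rightarrow> int" where "s b = (if b = 0 then 1 else -1)" for b
  interpret S: subgroup S G by (rule S)
  have s_add: "s (b + c) = s b * s c" for b c by (cases b; cases c) (simp_all add: s_def)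
  have translate: "(\<Sum>z\<in>H. f (z \<otimes> d)) = (\<Sum>z\<in>H. f z)" if "subgroup H G" "d \<in> H" for H d and f :: "'a \<Rightarrow> int"
  proof (rule sum.reindex_bij_witness[where i = "\<lambda>z. z \<otimes> d" and j = "\<lambda>z. z \<otimes> d"])
    interpret H: subgroup H G by (rule that)
    show "z \<otimes> d \<otimes> d = z" "z \<otimes> d \<in> H" if "z \<in> H" for z
      using that \<open>d \<in> H\<close> by (simp_all add: mult_cancel_right)
    then show "z \<otimes> d \<otimes> d = z" "z \<otimes> d \<in> H" if "z \<in> H" for z using that by blast+
  qed simp
  have shift: "(\<Sum>z\<in>carrier G. s (q z)) = (\<Sum>z\<in>carrier G. s (q z) * s (B z d))" if "d \<in> S" for d
    unfolding translate[OF subgroup_self S.mem_carrier[OF that], of "\<lambda>z. s (q z)", symmetric]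
    using that S(2) by (intro sum.cong) (simp_all add: q_mult singular_def flip: s_add)
  have character: "(\<Sum>d\<in>S. s (B z d)) = (if \<forall>y\<in>S. B z y = 0 then int (card S) else 0)"
    if z: "z \<in> carrier G" for z
  proof (cases "\<forall>y\<in>S. B z y = 0")
    case False
    then obtain c where c: "c \<in> S" "B z c = 1" by auto
    have "(\<Sum>d\<in>S. s (B z d)) = (\<Sum>d\<in>S. s (B z (d \<otimes> c)))"
      using translate[OF S(1) c(1), of "\<lambda>d. s (B z d)"] by simp
    \<comment> \<open>Translation by \<open>c\<close> negates every summand, so the sum equals its
      own negative.\<close>
    also have "\<dots> = (\<Sum>d\<in>S. - s (B z d))"
      using c z by (intro sum.cong) (simp_all add: B_mult_right s_add, simp add: s_def)
    finally show ?thesis using c by (auto simp: sum_negf)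
  qed (simp add: s_def)
  have "int (card S) * (\<Sum>z\<in>carrier G. s (q z)) = (\<Sum>d\<in>S. \<Sum>z\<in>carrier G. s (q z) * s (B z d))"
    by (simp flip: shift)
  also have "\<dots> = (\<Sum>z\<in>carrier G. s (q z) * (\<Sum>d\<in>S. s (B z d)))"
    by (subst sum.swap) (simp add: sum_distrib_left)
  also have "\<dots> = (\<Sum>z\<in>carrier G. if \<forall>y\<in>S. B z y = 0 then int (card S) * s (q z) else 0)"
    by (intro sum.cong) (auto simp: character)
  also have "\<dots> = int (card S) * (\<Sum>z\<in>{z \<in> carrier G. \<forall>y\<in>S. B z y = 0}. s (q z))"
    unfolding sum.inter_filter[OF finite_carrier] sum_distrib_left by (intro sum.cong) auto
  finally have "(\<Sum>z\<in>carrier G. s (q z)) = (\<Sum>z\<in>{z \<in> carrier G. \<forall>y\<in>S. B z y = 0}. s (q z))"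
    using S.one_closed finite_subset[OF S.subset finite_carrier] by auto
  then show ?thesis by (simp add: s_def)
qed

section \<open>Singular neighbours of a Lagrangian subgroup with an odd element\<close>

context
  fixes D d
  assumes D: "lagrangian D" and d: "d \<in> D" "q d = 1"
begin

interpretation D: subgroup D G
  by (rule lagrangian_subgroup[OF D])

lemma q_add_lagrangian: "x \<in> D \<Longrightarrow> y \<in> D \<Longrightarrow> q (x \<otimes> y) = q x + q y"
  by (simp add: q_mult lagrangian_B[OF D])

lemma subgroup_singular_part: "subgroup {z \<in> D. q z = 0} G"
proof (rule subgroupI)
  show "{z \<in> D. q z = 0} \<noteq> {}" using D.one_closed q_one by blast
qed (use D.mem_carrier in \<open>auto simp: inv_eq_self q_add_lagrangian\<close>)

text \<open>\<open>q\<close> is additive on \<open>D\<close>, so the singular part and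
  \<open>d\<close> generate \<open>D\<close>.\<close>

lemma mem_of_orthogonal:
  assumes "z \<in> carrier G" "\<And>y. y \<in> D \<Longrightarrow> q y = 0 \<Longrightarrow> B z y = 0" "B z d = 0"
  shows "z \<in> D"
proof (rule lagrangianD[OF D assms(1)])
  fix y assume y: "y \<in> D"
  show "B z y = 0"
  proof (cases "q y = 0")
    case False
    then have "B z (y \<otimes> d) = 0" using y d by (intro assms(2)) (simp_all add: q_add_lagrangian)
    then show ?thesis using y d assms by (simp add: B_mult_right)
  qed (use y assms in blast)
qed

text \<open>Otherwise every element of \<open>?U\<close> outside \<open>?D0\<close> would be odd,
  and the Gauss sum over \<open>?U\<close> would be the size of \<open>?D0\<close> minus the size of
  \<open>?U - ?D0\<close>. The latter set contains the translate of \<open>?D0\<close> by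
  \<open>d\<close>, so the sum could not be positive.\<close>

lemma singular_orthogonal_exists:
  "\<exists>e \<in> carrier G. e \<notin> D \<and> q e = 0 \<and> (\<forall>y\<in>D. q y = 0 \<longrightarrow> B e y = 0)"
proof (rule ccontr)
  assume no: "\<not> ?thesis"
  let ?D0 = "{z \<in> D. q z = 0}"
  let ?U = "{z \<in> carrier G. \<forall>y\<in>?D0. B z y = 0}"
  have fin: "finite ?U" "finite D" using finite_carrier finite_subset[OF D.subset] by auto
  have sub: "?D0 \<union> (?D0 #> d) \<subseteq> ?U"
  proof -
    have "?D0 #> d \<subseteq> D" using d by (auto simp: r_coset_def)
    then have "?D0 \<union> (?D0 #> d) \<subseteq> D" by blast
    then show ?thesis using D.subset lagrangian_B[OF D] by blast
  qed
  have "card (?D0 #> d) = card ?D0"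
    using d D.subset by (intro card_rcosets_equal[symmetric] rcosetsI) auto
  have disj: "?D0 \<inter> (?D0 #> d) = {}"
    using d by (auto simp: r_coset_def q_add_lagrangian)
  have "0 < (\<Sum>z\<in>?U. if q z = 0 then 1 else -1 :: int)"
    using gauss_sum_pos gauss_sum_orthogonal[OF subgroup_singular_part] by (simp add: singular_def)
  also have "\<dots> = (\<Sum>z\<in>?D0. 1) + (\<Sum>z\<in>?U - ?D0. -1 :: int)"
  proof -
    have "(\<Sum>z\<in>?D0. if q z = 0 then 1 else -1 :: int) = (\<Sum>z\<in>?D0. 1)"
      by (rule sum.cong) simp_all
    moreover have "(\<Sum>z\<in>?U - ?D0. if q z = 0 then 1 else -1 :: int) = (\<Sum>z\<in>?U - ?D0. -1)"
    proof (rule sum.cong[OF refl])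
      fix z assume "z \<in> ?U - ?D0"
      then have "q z \<noteq> 0" using no by blast
      then show "(if q z = 0 then 1 else -1 :: int) = -1" by (rule if_not_P)
    qed
    moreover have "?D0 \<subseteq> ?U" using sub by blast
    ultimately show ?thesis
      using sum.subset_diff[OF _ fin(1), of ?D0 "\<lambda>z. if q z = 0 then 1 else -1 :: int"] by presburger
  qed
  also have "\<dots> \<le> int (card ?D0) - int (card (?D0 #> d))"
    using card_mono[of "?U - ?D0" "?D0 #> d"] sub disj fin by auto
  finally show False using \<open>card (?D0 #> d) = card ?D0\<close> by simp
qed

lemma B_odd_eq_1:
  assumes "z \<in> carrier G" "\<And>y. y \<in> D \<Longrightarrow> q y = 0 \<Longrightarrow> B z y = 0" "z \<notin> D"
  shows "B z d = 1"
  using mem_of_orthogonal[OF assms(1,2)] assms(3) by (metis bit_not_zero_iff)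

text \<open>The neighbour is the singular part of \<open>D\<close> with a singular \<open>e\<close>
  adjoined. That nothing else is orthogonal to it is seen from the pairings with \<open>d\<close>
  and \<open>e\<close>, which separate the four classes modulo the singular part: (0,0) for zero,
  (0,1) for \<open>d\<close>, (1,0) for \<open>e\<close>, (1,1) for their product.\<close>

lemma singular_neighbour_exists: "\<exists>C. lagrangian C \<and> singular C \<and> {z \<in> D. q z = 0} \<subseteq> C"
proof -
  obtain e where e: "e \<in> carrier G" "e \<notin> D" "q e = 0" "\<And>y. y \<in> D \<Longrightarrow> q y = 0 \<Longrightarrow> B e y = 0"
    using singular_orthogonal_exists by blast
  have dc: "d \<in> carrier G" using d by simp
  define C where "C = {z \<in> carrier G. z \<in> D \<and> q z = 0 \<or> z \<otimes> e \<in> D \<and> q (z \<otimes> e) = 0}"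
  have De: "B y e = 0" if "y \<in> D" "q y = 0" for y using that e B_sym[of y e] D.mem_carrier by simp
  have C_cases: "\<exists>y\<in>D. q y = 0 \<and> (z = y \<or> z = y \<otimes> e)" if "z \<in> C" for z
  proof -
    have "z = z \<otimes> e \<otimes> e" using that e(1) by (simp add: C_def mult_cancel_right)
    then show ?thesis using that unfolding C_def by blast
  qed
  have "lagrangian C"
    unfolding lagrangian_def
  proof (intro equalityI subsetI)
    fix z assume z: "z \<in> C"
    have "B z w = 0" if w: "w \<in> C" for w
    proof -
      obtain x where x: "x \<in> D" "q x = 0" "z = x \<or> z = x \<otimes> e" using C_cases[OF z] by blast
      obtain y where y: "y \<in> D" "q y = 0" "w = y \<or> w = y \<otimes> e" using C_cases[OF w] by blast
      have "B x y = 0" "B x e = 0" "B e y = 0"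
        using lagrangian_B[OF D x(1) y(1)] De[OF x(1,2)] e(4)[OF y(1,2)] by blast+
      then show ?thesis using x(3) y(3) e(1) D.mem_carrier[OF x(1)] D.mem_carrier[OF y(1)]
        by (elim disjE) (simp_all add: B_mult_left B_mult_right B_self)
    qed
    then show "z \<in> {z \<in> carrier G. \<forall>w\<in>C. B z w = 0}" using z by (simp add: C_def)
  next
    fix z assume "z \<in> {z \<in> carrier G. \<forall>w\<in>C. B z w = 0}"
    then have z: "z \<in> carrier G" "\<And>w. w \<in> C \<Longrightarrow> B z w = 0" by auto
    have "e \<in> C" using e D.one_closed by (simp add: C_def mult_self q_one)
    then have ze: "B z e = 0" by (rule z)
    have zD: "B z y = 0" if "y \<in> D" "q y = 0" for y using z(2)[of y] that by (simp add: C_def)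
    have *: "v \<in> D \<and> q v = 0"
      if v: "v \<in> carrier G" "\<And>y. y \<in> D \<Longrightarrow> q y = 0 \<Longrightarrow> B v y = 0" "B v d = 0" "B v e = 0" for v
    proof -
      have vD: "v \<in> D" using v(1-3) by (rule mem_of_orthogonal)
      have "q v = 0"
      proof (rule ccontr)
        \<comment> \<open>For odd \<open>v\<close> the product \<open>v \<otimes> d\<close> is
          singular in \<open>D\<close>, hence orthogonal to \<open>e\<close>; but
          \<open>B v e = 0\<close> and \<open>B d e = 1\<close>.\<close>
        assume "q v \<noteq> 0"
        then have "B (v \<otimes> d) e = 0" using vD d by (intro De) (simp_all add: q_add_lagrangian)
        moreover have "B d e = 1" using B_odd_eq_1[OF e(1,4,2)] B_sym[OF dc e(1)] by simp
        ultimately show False using v e dc by (simp add: B_mult_left)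
      qed
      with vD show ?thesis ..
    qed
    show "z \<in> C"
    proof (cases "B z d = 0")
      case True
      then show ?thesis using *[OF z(1) zD] ze z by (simp add: C_def)
    next
      case False
      \<comment> \<open>Since \<open>B e d = 1\<close>, adding \<open>e\<close> repairs the pairing
        with \<open>d\<close>; the pairings with \<open>e\<close> and with the singular part stay
        zero.\<close>
      then have "B (z \<otimes> e) d = 0" using B_odd_eq_1[OF e(1,4,2)] z e dc by (simp add: B_mult_left)
      then have "z \<otimes> e \<in> D \<and> q (z \<otimes> e) = 0" using z e zD ze
        by (intro *) (simp_all add: B_mult_left B_self)
      then show ?thesis using z by (simp add: C_def)
    qed
  qed
  moreover have "singular C"
    unfolding singular_def
  proof
    fix z assume "z \<in> C"
    then obtain y where y: "y \<in> D" "q y = 0" "z = y \<or> z = y \<otimes> e" using C_cases by blast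
    then show "q z = 0" using e(1,3) De[OF y(1,2)] D.mem_carrier[OF y(1)]
      by (elim disjE) (simp_all add: q_mult)
  qed
  moreover have "{z \<in> D. q z = 0} \<subseteq> C" by (auto simp: C_def)
  ultimately show ?thesis by blast
qed

text \<open>Elements of \<open>C\<close> or \<open>C'\<close> outside \<open>D\<close> all pair to 1
  with \<open>d\<close>, so the product of any two of them lies in \<open>D\<close>. Applied to
  \<open>e\<close> and an \<open>e0\<close> separating the two codes, this shows
  \<open>e \<notin> C'\<close>. For \<open>e'\<close> in \<open>C'\<close> outside \<open>D\<close>
  the product \<open>e \<otimes> e'\<close> must then be odd, as otherwise it would put
  \<open>e\<close> into \<open>C'\<close>; multiplied by \<open>d\<close> it becomes a singular
  element of \<open>D\<close>, hence an element of \<open>C'\<close>.\<close>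

lemma other_singular_neighbour:
  assumes C: "lagrangian C" "singular C" "{z \<in> D. q z = 0} \<subseteq> C"
    and C': "lagrangian C'" "singular C'" "{z \<in> D. q z = 0} \<subseteq> C'"
    and "C \<noteq> C'" and e: "e \<in> C" "e \<notin> D"
  shows "e \<otimes> d \<in> C'"
proof -
  interpret C: subgroup C G by (rule lagrangian_subgroup[OF C(1)])
  interpret C': subgroup C' G by (rule lagrangian_subgroup[OF C'(1)])
  have dc: "d \<in> carrier G" using d by simp
  have D0: "x \<in> C'" if "x \<in> D" "q x = 0" for x using that C' by blast
  obtain e0 where e0: "e0 \<in> C" "e0 \<notin> C'" using lagrangian_subset_eq[OF C(1) C'(1)] \<open>C \<noteq> C'\<close> by blast
  then have "e0 \<notin> D" using D0 C(2) by (auto simp: singular_def)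
  have "C' \<noteq> D" using C'(2) d by (auto simp: singular_def)
  then obtain e' where e': "e' \<in> C'" "e' \<notin> D" using lagrangian_subset_eq[OF C'(1) D] by blast
  have C_orth: "B w y = 0" if "w \<in> C" "y \<in> D" "q y = 0" for w y
    using lagrangian_B[OF C(1)] that C(3) by blast
  have C'_orth: "B w y = 0" if "w \<in> C'" "y \<in> D" "q y = 0" for w y
    using lagrangian_B[OF C'(1)] that C'(3) by blast
  have Cd: "B w d = 1" if "w \<in> C" "w \<notin> D" for w
    using C.mem_carrier[OF that(1)] C_orth[OF that(1)] that(2) by (rule B_odd_eq_1)
  have C'd: "B w d = 1" if "w \<in> C'" "w \<notin> D" for w
    using C'.mem_carrier[OF that(1)] C'_orth[OF that(1)] that(2) by (rule B_odd_eq_1)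
  have "e \<otimes> e0 \<in> D"
  proof (rule mem_of_orthogonal)
    show "B (e \<otimes> e0) y = 0" if "y \<in> D" "q y = 0" for y
      using that C_orth e e0 by (simp add: B_mult_left)
    show "B (e \<otimes> e0) d = 0" using Cd e e0 \<open>e0 \<notin> D\<close> dc by (simp add: B_mult_left)
  qed (use e e0 in simp)
  moreover have "q (e \<otimes> e0) = 0" using C.m_closed[OF e(1) e0(1)] C(2) by (auto simp: singular_def)
  ultimately have "e \<otimes> e0 \<in> C'" by (rule D0)
  then have "e \<notin> C'" using subgroup_mult_iff[OF C'.subgroup_axioms, of e e0] e0 by auto
  have "e \<otimes> e' \<in> D"
  proof (rule mem_of_orthogonal)
    show "B (e \<otimes> e') y = 0" if "y \<in> D" "q y = 0" for y
      using that C_orth C'_orth e e' by (simp add: B_mult_left)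
    show "B (e \<otimes> e') d = 0" using Cd C'd e e' dc by (simp add: B_mult_left)
  qed (use e e' in simp)
  moreover have "q (e \<otimes> e') = 1"
  proof (rule ccontr)
    assume "q (e \<otimes> e') \<noteq> 1"
    then have "e' \<otimes> e \<in> C'" using D0[OF \<open>e \<otimes> e' \<in> D\<close>] e e' by (simp add: m_comm)
    then show False using \<open>e \<notin> C'\<close> subgroup_mult_iff[OF C'.subgroup_axioms e'(1) C.mem_carrier[OF e(1)]] by blast
  qed
  ultimately have "e \<otimes> e' \<otimes> d \<in> C'" using d by (intro D0) (simp_all add: q_add_lagrangian)
  moreover have "e \<otimes> e' \<otimes> d = e' \<otimes> (e \<otimes> d)" using e e' dc by (simp add: m_ac)
  ultimately show ?thesis using subgroup_mult_iff[OF C'.subgroup_axioms e'(1), of "e \<otimes> d"] e dc by simp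
qed

text \<open>Passing from one neighbour to a different one multiplies the elements outside
  \<open>D\<close> by \<open>d\<close>. Going from \<open>C'\<close> to \<open>C\<close> and on to
  \<open>C''\<close> multiplies by \<open>d\<close> twice, so every element returns to
  itself.\<close>

lemma at_most_two_singular_neighbours:
  assumes "lagrangian C" "singular C" "{z \<in> D. q z = 0} \<subseteq> C"
    and "lagrangian C'" "singular C'" "{z \<in> D. q z = 0} \<subseteq> C'"
    and "lagrangian C''" "singular C''" "{z \<in> D. q z = 0} \<subseteq> C''"
    and "C \<noteq> C'" "C \<noteq> C''"
  shows "C' = C''"
proof (rule lagrangian_subset_eq)
  show "C' \<subseteq> C''"
  proof
    fix f assume f: "f \<in> C'"
    then have fc: "f \<in> carrier G" "d \<in> carrier G" using lagrangian_carrier[OF assms(4)] d by auto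
    show "f \<in> C''"
    proof (cases "f \<in> D")
      case True
      then show ?thesis using f assms(5,9) by (auto simp: singular_def)
    next
      case False
      then have "f \<otimes> d \<in> C" using other_singular_neighbour[of C' C f] assms f by blast
      moreover have "f \<otimes> d \<notin> D"
        using False fc d subgroup_mult_iff[OF D.subgroup_axioms d(1) fc(1)] by (simp add: m_comm)
      ultimately have "f \<otimes> d \<otimes> d \<in> C''" using other_singular_neighbour[of C C'' "f \<otimes> d"] assms by blast
      then show ?thesis using fc by (simp add: mult_cancel_right)
    qed
  qed
qed (use assms in blast)+

text \<open>Both sides are Lagrangian, so it is enough to place \<open>D\<close> inside: its even
  elements are in \<open>C\<close> and orthogonal to the coset, and its odd elements lie in the
  coset of \<open>d\<close>.\<close>

lemma odd_neighbour_of_singular_neighbour: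
  assumes C: "lagrangian C" "singular C" "{z \<in> D. q z = 0} \<subseteq> C"
  shows "odd_neighbour C (C #> d) = D"
proof (rule lagrangian_subset_eq[symmetric])
  have dc: "d \<in> carrier G" "d \<notin> C" using d C(2) by (auto simp: singular_def)
  have sub: "subgroup C G" by (rule lagrangian_subgroup[OF C(1)])
  show "lagrangian (odd_neighbour C (C #> d))"
    by (rule odd_neighbour_lagrangian[OF C(1,2) dc])
  show "D \<subseteq> odd_neighbour C (C #> d)"
  proof
    fix z assume z: "z \<in> D"
    show "z \<in> odd_neighbour C (C #> d)"
    proof (cases "q z = 0")
      case True
      then have "z \<in> C" using z C by blast
      moreover have "B z x = 0" if "x \<in> C #> d" for x
        using coset_orthogonal_eq[OF C(1,2) dc \<open>z \<in> C\<close> that rcos_self[OF dc(1) sub]]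
          lagrangian_B[OF D z d(1)] by simp
      ultimately show ?thesis by (simp add: odd_neighbour_def)
    next
      case False
      then have "z \<otimes> d \<in> {z \<in> D. q z = 0}" using z d by (simp add: q_add_lagrangian)
      then have "z \<otimes> d \<in> C" by (rule subsetD[OF C(3)])
      then show ?thesis using False z dc by (simp add: odd_neighbour_def r_coset_iff[OF sub])
    qed
  qed
qed (rule D)

text \<open>\<open>C\<close> has no odd elements, so \<open>d\<close> can enter the neighbour only
  through the coset, which it then represents.\<close>

lemma singular_neighbour_of_odd_neighbour:
  assumes C: "lagrangian C" "singular C" and a: "a \<in> carrier G" "a \<notin> C"
    and eq: "odd_neighbour C (C #> a) = D"
  shows "{z \<in> D. q z = 0} \<subseteq> C \<and> C #> a = C #> d"
proof
  show "{z \<in> D. q z = 0} \<subseteq> C" using eq by (auto simp: odd_neighbour_def)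
  have "d \<in> C #> a" using eq d C(2) by (auto simp: odd_neighbour_def singular_def)
  then show "C #> a = C #> d" by (rule repr_independence[OF _ a(1) lagrangian_subgroup[OF C(1)]])
qed

end

section \<open>Transport along isometries\<close>

context
  fixes \<phi>
  assumes bij: "bij_betw \<phi> (carrier G) (carrier G)"
    and hom: "\<And>x y. x \<in> carrier G \<Longrightarrow> y \<in> carrier G \<Longrightarrow> \<phi> (x \<otimes> y) = \<phi> x \<otimes> \<phi> y"
    and B_isometry: "\<And>x y. x \<in> carrier G \<Longrightarrow> y \<in> carrier G \<Longrightarrow> B (\<phi> x) (\<phi> y) = B x y"
    and q_isometry: "\<And>x. x \<in> carrier G \<Longrightarrow> q (\<phi> x) = q x"
begin

lemma isometry_lagrangian:
  assumes C: "lagrangian C"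
  shows "lagrangian (\<phi> ` C)"
  unfolding lagrangian_def
proof (intro equalityI subsetI)
  fix z assume "z \<in> \<phi> ` C"
  then show "z \<in> {z \<in> carrier G. \<forall>y\<in>\<phi> ` C. B z y = 0}"
    using lagrangian_B[OF C] lagrangian_carrier[OF C] bij_betwE[OF bij] by (auto simp: B_isometry)
next
  fix z assume z: "z \<in> {z \<in> carrier G. \<forall>y\<in>\<phi> ` C. B z y = 0}"
  then obtain x where x: "x \<in> carrier G" "z = \<phi> x" using bij by (auto simp: bij_betw_def)
  then have "x \<in> C" using z lagrangian_carrier[OF C]
    by (intro lagrangianD[OF C]) (auto simp: B_isometry)
  then show "z \<in> \<phi> ` C" using x by blast
qed

lemma isometry_r_coset: "C \<subseteq> carrier G \<Longrightarrow> a \<in> carrier G \<Longrightarrow> \<phi> ` (C #> a) = \<phi> ` C #> \<phi> a"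
  by (auto simp: r_coset_def image_UN hom subset_iff)

lemma isometry_odd_neighbour:
  assumes "C \<subseteq> carrier G" "X \<subseteq> carrier G"
  shows "odd_neighbour (\<phi> ` C) (\<phi> ` X) = \<phi> ` odd_neighbour C X"
proof -
  have "{z \<in> \<phi> ` C. \<forall>x\<in>\<phi> ` X. B z x = 0} = \<phi> ` {z \<in> C. \<forall>x\<in>X. B z x = 0}"
    using assms by (auto simp: subset_iff B_isometry)
  moreover have "{z \<in> \<phi> ` X. q z = 1} = \<phi> ` {z \<in> X. q z = 1}"
    using assms by (auto simp: subset_iff q_isometry)
  ultimately show ?thesis by (simp add: odd_neighbour_def image_Un)
qed

end

end

section \<open>Isometries of \<open>L\<^sup>n\<close>\<close>

text \<open>The laws are asked on an ambient set \<open>X\<close> only and nothing is prescribed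
  outside it, so images of codes act as they are. Orbits of the codes or pairs in question are
  computed inside the set of all subsets, where no property of codes intervenes.\<close>

locale invariant_action = group G for G (structure) +
  fixes X :: "'x set" and \<phi> :: "'a \<Rightarrow> 'x \<Rightarrow> 'x"
  assumes closed: "\<lbrakk>g \<in> carrier G; x \<in> X\<rbrakk> \<Longrightarrow> \<phi> g x \<in> X"
    and act_mult: "\<lbrakk>g \<in> carrier G; h \<in> carrier G; x \<in> X\<rbrakk> \<Longrightarrow> \<phi> (g \<otimes> h) x = \<phi> g (\<phi> h x)"
    and act_one: "x \<in> X \<Longrightarrow> \<phi> \<one> x = x"
begin

lemma orbit_refl: "x \<in> X \<Longrightarrow> x \<in> orbit G \<phi> x"
  unfolding orbit_def using act_one[symmetric] one_closed by blast

lemma orbit_act: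
  assumes g: "g \<in> carrier G" and x: "x \<in> X"
  shows "orbit G \<phi> (\<phi> g x) = orbit G \<phi> x"
proof (intro equalityI subsetI)
  fix y assume "y \<in> orbit G \<phi> (\<phi> g x)"
  then obtain h where "h \<in> carrier G" "y = \<phi> (h \<otimes> g) x"
    using act_mult g x by (auto simp: orbit_def)
  then show "y \<in> orbit G \<phi> x" using g m_closed unfolding orbit_def by blast
next
  fix y assume "y \<in> orbit G \<phi> x"
  then obtain h where h: "h \<in> carrier G" "y = \<phi> h x" by (auto simp: orbit_def)
  then have "y = \<phi> ((h \<otimes> inv g) \<otimes> g) x" using g by (simp add: m_assoc)
  also have "\<dots> = \<phi> (h \<otimes> inv g) (\<phi> g x)" using g h x by (intro act_mult) simp_all
  finally show "y \<in> orbit G \<phi> (\<phi> g x)" using g h unfolding orbit_def by blast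
qed

lemma orbit_eq_iff:
  assumes "x \<in> X" "y \<in> X"
  shows "orbit G \<phi> x = orbit G \<phi> y \<longleftrightarrow> (\<exists>g\<in>carrier G. y = \<phi> g x)"
proof
  assume "orbit G \<phi> x = orbit G \<phi> y"
  then have "y \<in> orbit G \<phi> x" using orbit_refl[OF assms(2)] by simp
  then show "\<exists>g\<in>carrier G. y = \<phi> g x" by (auto simp: orbit_def)
qed (use orbit_act assms in auto)

end

section \<open>The weight form on words and the action of \<open>GG n\<close> by isometries\<close>

definition qf :: "nat \<Rightarrow> (nat \<Rightarrow> klein) \<Rightarrow> bit" where
  "qf n x = of_nat (ewt n x)"

lemma qf_eq_0_iff: "qf n x = 0 \<longleftrightarrow> even (ewt n x)"
proof -
  have "b = 0 \<longleftrightarrow> even b" for b :: bit by (cases b) simp_all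
  then show ?thesis unfolding qf_def by (simp only: even_of_nat)
qed

lemma qf_eq_1_iff: "qf n x = 1 \<longleftrightarrow> odd (ewt n x)"
  by (simp flip: qf_eq_0_iff)

lemma qf_eq_sum: "qf n x = (\<Sum>i<n. of_nat (norm2 (x i)))"
  by (simp add: qf_def ewt_def)

lemma UNIV_klein: "(UNIV :: klein set) = {L0, L1, Om, OmBar}"
  using klein.exhaust by blast

lemma Lpow_mult: "x \<otimes>\<^bsub>Lpow n\<^esub> y = (\<lambda>i\<in>{..<n}. klein_add (x i) (y i))"
  by (simp add: Lpow_def klein_group_def)

lemma Lpow_one: "\<one>\<^bsub>Lpow n\<^esub> = (\<lambda>i\<in>{..<n}. L0)"
  by (simp add: Lpow_def klein_group_def)

lemma klein_add_self: "klein_add a a = L0"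
  by (cases a) simp_all

lemma dot_klein_add: "dot (klein_add a b) c = dot a c + dot b c"
  by (cases a; cases b; cases c) (simp_all add: dot_def)

lemma norm2_klein_add: "(of_nat (norm2 (klein_add a b)) :: bit) = of_nat (norm2 a) + of_nat (norm2 b) + dot a b"
  by (cases a; cases b) (simp_all add: dot_def)

text \<open>The sign is multiplicative over coordinates, so the sum factors; only \<open>L1\<close>
  has odd norm, so each factor is 1 - 1 + 1 + 1.\<close>

lemma gauss_sum_Lpow: "(\<Sum>z\<in>carrier (Lpow n). if qf n z = 0 then 1 else -1 :: int) = 2 ^ n"
proof -
  define s :: "bit \<Rightarrow> int" where "s b = (if b = 0 then 1 else -1)" for b
  have "s (\<Sum>i\<in>A. f i) = (\<Prod>i\<in>A. s (f i))" if "finite A" for A :: "nat set" and f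
    using that
  proof induction
    case (insert x A)
    have "s (b + c) = s b * s c" for b c by (cases b; cases c) (simp_all add: s_def)
    then show ?case using insert by simp
  qed (simp add: s_def)
  then have "(\<Sum>z\<in>carrier (Lpow n). s (qf n z)) =
      (\<Sum>z\<in>{..<n} \<rightarrow>\<^sub>E UNIV. \<Prod>i<n. s (of_nat (norm2 (z i))))"
    by (simp add: qf_eq_sum carrier_Lpow)
  also have "\<dots> = (\<Prod>i<n. \<Sum>a\<in>UNIV. s (of_nat (norm2 a)))"
    by (rule prod_sum_PiE[symmetric]) (simp_all add: UNIV_klein)
  also have "\<dots> = 2 ^ n" by (simp add: UNIV_klein s_def)
  finally show ?thesis by (simp add: s_def)
qed

lemma binary_quadratic_space_Lpow: "binary_quadratic_space (Lpow n) (ip n) (qf n)"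
proof (intro binary_quadratic_space.intro comm_group_Lpow binary_quadratic_space_axioms.intro)
  show "x \<otimes>\<^bsub>Lpow n\<^esub> x = \<one>\<^bsub>Lpow n\<^esub>" for x
    by (simp add: Lpow_mult Lpow_one klein_add_self)
  show "ip n (x \<otimes>\<^bsub>Lpow n\<^esub> y) z = ip n x z + ip n y z" for x y z
    unfolding ip_def sum.distrib[symmetric]
    by (rule sum.cong) (simp_all only: Lpow_mult restrict_apply' dot_klein_add)
  show "qf n (x \<otimes>\<^bsub>Lpow n\<^esub> y) = qf n x + qf n y + ip n x y" for x y
    unfolding ip_def qf_eq_sum sum.distrib[symmetric]
    by (rule sum.cong) (simp_all only: Lpow_mult restrict_apply' norm2_klein_add)
  show "finite (carrier (Lpow n))"
    by (simp add: carrier_Lpow finite_PiE UNIV_klein)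
qed (simp add: gauss_sum_Lpow)

abbreviation neighbour :: "nat \<Rightarrow> code \<Rightarrow> code \<Rightarrow> code" where
  "neighbour n \<equiv> binary_quadratic_space.odd_neighbour (ip n) (qf n)"

text \<open>The rewrites hold because a set equal to its orthogonal space is a subgroup, and because
  \<open>qf n\<close> vanishes exactly at even weight.\<close>

interpretation L: binary_quadratic_space "Lpow n" "ip n" "qf n"
  rewrites "binary_quadratic_space.lagrangian (Lpow n) (ip n) = self_dual n"
    and "binary_quadratic_space.singular (qf n) = even_code n"
  for n
proof -
  interpret Q: binary_quadratic_space "Lpow n" "ip n" "qf n"
    by (rule binary_quadratic_space_Lpow)
  show "binary_quadratic_space (Lpow n) (ip n) (qf n)" by (rule binary_quadratic_space_Lpow)
  show "Q.lagrangian = self_dual n"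
    using Q.lagrangian_subgroup by (auto simp: fun_eq_iff self_dual_def Q.lagrangian_def)
  show "Q.singular = even_code n"
    by (simp add: fun_eq_iff even_code_def Q.singular_def qf_eq_0_iff)
qed

lemma self_dual_subset: "self_dual n C \<Longrightarrow> C \<subseteq> carrier (Lpow n)"
  using L.lagrangian_carrier by blast

lemma vec_act_hom:
  assumes g: "g \<in> carrier (GG n)" and xy: "x \<in> carrier (Lpow n)" "y \<in> carrier (Lpow n)"
  shows "vec_act n g (x \<otimes>\<^bsub>Lpow n\<^esub> y) = vec_act n g x \<otimes>\<^bsub>Lpow n\<^esub> vec_act n g y"
proof -
  obtain A \<pi> where g: "g = (A, \<pi>)" "\<pi> permutes {..<n}" using g by (auto simp: GG_def)
  have "Hilbert_Choice.inv \<pi> i < n" if "i < n" for i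
    using permutes_in_image[OF permutes_inv[OF g(2)], of i] that by simp
  moreover have "conj_klein (klein_add a b) = klein_add (conj_klein a) (conj_klein b)" for a b
    by (cases a; cases b) simp_all
  ultimately show ?thesis
    using xy by (auto simp: g(1) vec_act_apply L.m_closed Lpow_mult fun_eq_iff carrier_Lpow)
qed

text \<open>One reindexing serves both \<open>ip\<close> and \<open>ewt\<close>, the latter with an
  \<open>f\<close> that ignores its second argument.\<close>

lemma vec_act_sum:
  fixes f :: "klein \<Rightarrow> klein \<Rightarrow> 'b :: comm_monoid_add"
  assumes g: "g \<in> carrier (GG n)" and xy: "x \<in> carrier (Lpow n)" "y \<in> carrier (Lpow n)"
    and f: "\<And>a b. f (conj_klein a) (conj_klein b) = f a b"
  shows "(\<Sum>i<n. f (vec_act n g x i) (vec_act n g y i)) = (\<Sum>i<n. f (x i) (y i))"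
proof -
  obtain A \<pi> where g: "g = (A, \<pi>)" "\<pi> permutes {..<n}" using g by (auto simp: GG_def)
  have "(\<Sum>i<n. f (vec_act n g x i) (vec_act n g y i)) =
      (\<Sum>i<n. f (x (Hilbert_Choice.inv \<pi> i)) (y (Hilbert_Choice.inv \<pi> i)))"
    using xy f by (intro sum.cong) (simp_all add: g(1) vec_act_apply)
  also have "\<dots> = (\<Sum>i<n. f (x i) (y i))"
    using sum.permute[OF permutes_inv[OF g(2)], of "\<lambda>i. f (x i) (y i)"] by (simp add: o_def)
  finally show ?thesis .
qed

lemma ip_vec_act:
  "\<lbrakk>g \<in> carrier (GG n); x \<in> carrier (Lpow n); y \<in> carrier (Lpow n)\<rbrakk> \<Longrightarrow>
    ip n (vec_act n g x) (vec_act n g y) = ip n x y"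
proof -
  have "dot (conj_klein a) (conj_klein b) = dot a b" for a b
    by (cases a; cases b) (simp_all add: dot_def)
  then show "\<lbrakk>g \<in> carrier (GG n); x \<in> carrier (Lpow n); y \<in> carrier (Lpow n)\<rbrakk> \<Longrightarrow>
      ip n (vec_act n g x) (vec_act n g y) = ip n x y"
    unfolding ip_def by (intro vec_act_sum)
qed

lemma ewt_vec_act:
  "\<lbrakk>g \<in> carrier (GG n); x \<in> carrier (Lpow n)\<rbrakk> \<Longrightarrow> ewt n (vec_act n g x) = ewt n x"
proof -
  have "norm2 (conj_klein a) = norm2 a" for a by (cases a) simp_all
  then show "\<lbrakk>g \<in> carrier (GG n); x \<in> carrier (Lpow n)\<rbrakk> \<Longrightarrow> ewt n (vec_act n g x) = ewt n x"
    unfolding ewt_def using vec_act_sum[of g n x x "\<lambda>a b. norm2 a"] by simp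
qed

lemma bij_betw_vec_act:
  assumes "g \<in> carrier (GG n)"
  shows "bij_betw (vec_act n g) (carrier (Lpow n)) (carrier (Lpow n))"
  using group_action.bij_prop0[OF group_action_vec_act assms] by (simp add: Bij_def)

lemma vec_act_isometry:
  assumes g: "g \<in> carrier (GG n)"
  shows "\<And>x y. x \<in> carrier (Lpow n) \<Longrightarrow> y \<in> carrier (Lpow n) \<Longrightarrow>
      vec_act n g (x \<otimes>\<^bsub>Lpow n\<^esub> y) = vec_act n g x \<otimes>\<^bsub>Lpow n\<^esub> vec_act n g y"
    and "\<And>x y. x \<in> carrier (Lpow n) \<Longrightarrow> y \<in> carrier (Lpow n) \<Longrightarrow>
      ip n (vec_act n g x) (vec_act n g y) = ip n x y"
    and "\<And>x. x \<in> carrier (Lpow n) \<Longrightarrow> qf n (vec_act n g x) = qf n x"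
  by (simp_all add: g vec_act_hom ip_vec_act ewt_vec_act qf_def)

lemma code_act_subset: "C \<subseteq> carrier (Lpow n) \<Longrightarrow> code_act n g C \<subseteq> carrier (Lpow n)"
  by (auto simp: code_act_def vec_act_closed)

context
  fixes n g
  assumes g: "g \<in> carrier (GG n)"
begin

lemma code_act_self_dual: "self_dual n C \<Longrightarrow> self_dual n (code_act n g C)"
  unfolding code_act_def
  by (rule L.isometry_lagrangian[OF bij_betw_vec_act[OF g] vec_act_isometry[OF g]])

lemma code_act_even: "C \<subseteq> carrier (Lpow n) \<Longrightarrow> even_code n (code_act n g C) \<longleftrightarrow> even_code n C"
  by (auto simp: code_act_def even_code_def ewt_vec_act g subset_iff)

lemma code_act_r_coset:
  "C \<subseteq> carrier (Lpow n) \<Longrightarrow> a \<in> carrier (Lpow n) \<Longrightarrow>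
    code_act n g (C #>\<^bsub>Lpow n\<^esub> a) = code_act n g C #>\<^bsub>Lpow n\<^esub> vec_act n g a"
  unfolding code_act_def
  by (rule L.isometry_r_coset[OF bij_betw_vec_act[OF g] vec_act_isometry[OF g]])

lemma code_act_neighbour:
  "C \<subseteq> carrier (Lpow n) \<Longrightarrow> X \<subseteq> carrier (Lpow n) \<Longrightarrow>
    neighbour n (code_act n g C) (code_act n g X) = code_act n g (neighbour n C X)"
  unfolding code_act_def
  by (rule L.isometry_odd_neighbour[OF bij_betw_vec_act[OF g] vec_act_isometry[OF g]])

lemma vec_act_mem_code_act_iff:
  "C \<subseteq> carrier (Lpow n) \<Longrightarrow> x \<in> carrier (Lpow n) \<Longrightarrow> vec_act n g x \<in> code_act n g C \<longleftrightarrow> x \<in> C"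
  unfolding code_act_def using bij_betw_imp_inj_on[OF bij_betw_vec_act[OF g]]
  by (simp add: inj_on_image_mem_iff)

end

interpretation code: invariant_action "GG n" "Pow (carrier (Lpow n))" "code_act n" for n
proof (intro invariant_action.intro group_GG invariant_action_axioms.intro)
  show "code_act n (g \<otimes>\<^bsub>GG n\<^esub> h) C = code_act n g (code_act n h C)"
    if "g \<in> carrier (GG n)" "h \<in> carrier (GG n)" "C \<in> Pow (carrier (Lpow n))" for g h C
    using that by (auto simp: code_act_def vec_act_mult image_comp intro!: image_cong)
  show "code_act n \<one>\<^bsub>GG n\<^esub> C = C" if "C \<in> Pow (carrier (Lpow n))" for C
    using that by (auto simp: code_act_def vec_act_one image_iff subset_iff)
qed (simp add: code_act_subset)

interpretation coset_pair: invariant_action "GG n"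
  "Pow (carrier (Lpow n)) \<times> Pow (carrier (Lpow n))" "coset_pair_act n" for n
proof (intro invariant_action.intro group_GG invariant_action_axioms.intro)
  show "coset_pair_act n g P \<in> Pow (carrier (Lpow n)) \<times> Pow (carrier (Lpow n))"
    if "g \<in> carrier (GG n)" "P \<in> Pow (carrier (Lpow n)) \<times> Pow (carrier (Lpow n))" for g P
    using that by (auto simp: coset_pair_act_def dest: code_act_subset[THEN subsetD, rotated])
  show "coset_pair_act n (g \<otimes>\<^bsub>GG n\<^esub> h) P = coset_pair_act n g (coset_pair_act n h P)"
    if "g \<in> carrier (GG n)" "h \<in> carrier (GG n)"
      "P \<in> Pow (carrier (Lpow n)) \<times> Pow (carrier (Lpow n))" for g h P
    using that by (auto simp: coset_pair_act_def code.act_mult)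
  show "coset_pair_act n \<one>\<^bsub>GG n\<^esub> P = P"
    if "P \<in> Pow (carrier (Lpow n)) \<times> Pow (carrier (Lpow n))" for P
    using that by (auto simp: coset_pair_act_def code.act_one)
qed

section \<open>Pairs \<open>(C, [x])\<close>\<close>

lemma coset_pairs_iff:
  "(C, X) \<in> coset_pairs n \<longleftrightarrow> self_dual n C \<and> even_code n C \<and>
    (\<exists>a\<in>carrier (Lpow n). a \<notin> C \<and> X = C #>\<^bsub>Lpow n\<^esub> a)"
proof (cases "self_dual n C")
  case True
  then have sub: "subgroup C (Lpow n)" by (rule L.lagrangian_subgroup)
  have "C #>\<^bsub>Lpow n\<^esub> a = C \<longleftrightarrow> a \<in> C" if "a \<in> carrier (Lpow n)" for a
    using L.coset_join1[OF _ that sub] L.coset_join2[OF that sub] by blast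
  then show ?thesis by (auto simp: coset_pairs_def FactGroup_def RCOSETS_def)
qed (simp add: coset_pairs_def)

lemma coset_pairsE:
  assumes "(C, X) \<in> coset_pairs n"
  obtains a where "self_dual n C" "even_code n C" "a \<in> carrier (Lpow n)" "a \<notin> C"
    "X = C #>\<^bsub>Lpow n\<^esub> a"
  using assms by (auto simp: coset_pairs_iff)

lemma coset_pairs_subset:
  assumes "(C, X) \<in> coset_pairs n"
  shows "C \<subseteq> carrier (Lpow n) \<and> X \<subseteq> carrier (Lpow n)"
  using assms by (rule coset_pairsE) (use L.r_coset_subset_G self_dual_subset in blast)

lemma coset_pairs_closed:
  assumes P: "(C, X) \<in> coset_pairs n" and g: "g \<in> carrier (GG n)"
  shows "(code_act n g C, code_act n g X) \<in> coset_pairs n"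
proof -
  from P obtain a where C: "self_dual n C" "even_code n C"
    and a: "a \<in> carrier (Lpow n)" "a \<notin> C" "X = C #>\<^bsub>Lpow n\<^esub> a"
    by (rule coset_pairsE)
  have "code_act n g X = code_act n g C #>\<^bsub>Lpow n\<^esub> vec_act n g a"
    using a C by (simp add: code_act_r_coset[OF g] self_dual_subset)
  moreover have "vec_act n g a \<notin> code_act n g C"
    using a C by (simp add: vec_act_mem_code_act_iff[OF g] self_dual_subset)
  ultimately show ?thesis
    using C vec_act_closed[OF a(1), of g]
    by (auto simp: coset_pairs_iff code_act_self_dual[OF g] code_act_even[OF g self_dual_subset])
qed

context
  fixes n C X
  assumes P: "(C, X) \<in> coset_pairs n"
begin

lemma coset_pair_orthogonal_eq:
  assumes "x \<in> X" "x' \<in> X"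
  shows "C \<inter> perp n x = C \<inter> perp n x'"
proof -
  from P obtain a where a: "self_dual n C" "even_code n C" "a \<in> carrier (Lpow n)" "a \<notin> C"
    "X = C #>\<^bsub>Lpow n\<^esub> a"
    by (rule coset_pairsE)
  have "ip n c x = ip n c x'" if "c \<in> C" for c
    using L.coset_orthogonal_eq[OF a(1-4) that] assms unfolding a(5) by blast
  then show ?thesis by (auto simp: perp_def)
qed

lemma coset_pair_odd: "\<exists>y\<in>X. odd (ewt n y)"
  using P by (rule coset_pairsE) (use L.coset_odd in \<open>simp flip: qf_eq_1_iff\<close>)

text \<open>The right-hand side mentions neither \<open>x\<close> nor \<open>y\<close>; the
  independence of both choices is read off from this.\<close>

lemma D_code_eq_neighbour:
  assumes "x \<in> X" "y \<in> X" "odd (ewt n y)"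
  shows "D_code n C x y = neighbour n C X"
  using P
proof (rule coset_pairsE)
  fix a assume a: "self_dual n C" "even_code n C" "a \<in> carrier (Lpow n)" "a \<notin> C"
    "X = C #>\<^bsub>Lpow n\<^esub> a"
  show ?thesis
    using L.odd_neighbour_eq[OF a(1-4), of x y] assms
    by (simp add: a(5) D_code_def Let_def perp_def qf_eq_1_iff)
qed

lemma neighbour_self_dual: "self_dual n (neighbour n C X)"
  using P by (rule coset_pairsE) (use L.odd_neighbour_lagrangian in blast)

lemma neighbour_not_even: "\<not> even_code n (neighbour n C X)"
  using P by (rule coset_pairsE) (use L.odd_neighbour_not_singular in blast)

end

text \<open>Equivariance of the neighbour: the elementwise image of an orbit of pairs is a full
  orbit of codes.\<close>

lemma image_neighbour_orbit:
  assumes P: "(C, X) \<in> coset_pairs n"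
  shows "(\<lambda>(C, X). neighbour n C X) ` orbit (GG n) (coset_pair_act n) (C, X) =
    orbit (GG n) (code_act n) (neighbour n C X)"
  using coset_pairs_subset[OF P]
  by (auto simp: orbit_def coset_pair_act_def code_act_neighbour image_iff) (metis code_act_neighbour)+

text \<open>With one odd \<open>d\<close> in \<open>D\<close> fixed, every pair over
  \<open>D\<close> is an even neighbour \<open>C\<close> of \<open>D\<close> together with the coset
  of \<open>d\<close>. So the fibre is the image under \<open>c\<close> of the set \<open>N\<close>
  of even neighbours, which is nonempty and has at most two members; \<open>c\<close> may identify
  them.\<close>

lemma card_neighbour_fibre:
  assumes Q: "Q \<in> code_classes n {D. self_dual n D \<and> \<not> even_code n D}"
  shows "card {P \<in> coset_pair_classes n. (\<lambda>(C, X). neighbour n C X) ` P = Q} \<in> {1, 2}"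
proof -
  obtain D where D: "self_dual n D" "\<not> even_code n D" and QD: "Q = orbit (GG n) (code_act n) D"
    using Q by (auto simp: code_classes_def orbits_def)
  obtain d where d: "d \<in> D" "qf n d = 1" using D by (auto simp: even_code_def qf_eq_1_iff)
  have dc: "d \<in> carrier (Lpow n)" using self_dual_subset[OF D(1)] d by blast
  define N where "N = {C. self_dual n C \<and> even_code n C \<and> {z \<in> D. qf n z = 0} \<subseteq> C}"
  define c where "c C = orbit (GG n) (coset_pair_act n) (C, C #>\<^bsub>Lpow n\<^esub> d)" for C
  have N: "(C, C #>\<^bsub>Lpow n\<^esub> d) \<in> coset_pairs n" if "C \<in> N" for C
    using that d dc by (auto simp: N_def coset_pairs_iff even_code_def qf_eq_1_iff)
  have F: "{P \<in> coset_pair_classes n. (\<lambda>(C, X). neighbour n C X) ` P = Q} = c ` N" (is "?F = _")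
  proof (intro equalityI subsetI)
    fix P assume "P \<in> ?F"
    then obtain C X where CX: "(C, X) \<in> coset_pairs n"
      and P: "P = orbit (GG n) (coset_pair_act n) (C, X)"
      and eq: "orbit (GG n) (code_act n) (neighbour n C X) = orbit (GG n) (code_act n) D"
      using image_neighbour_orbit unfolding QD coset_pair_classes_def orbits_def by fastforce
    \<comment> \<open>Only the class of the neighbour is known; moving the pair by \<open>g\<close>
      makes its neighbour equal to \<open>D\<close>.\<close>
    obtain g where g: "g \<in> carrier (GG n)" "D = code_act n g (neighbour n C X)"
      using eq code.orbit_eq_iff self_dual_subset[OF D(1)] self_dual_subset[OF neighbour_self_dual[OF CX]]
      by auto
    define C' X' where "C' = code_act n g C" "X' = code_act n g X"
    have CX': "(C', X') \<in> coset_pairs n" using coset_pairs_closed[OF CX g(1)] by (simp add: C'_X'_def)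
    have PC': "P = orbit (GG n) (coset_pair_act n) (C', X')"
      using coset_pair.orbit_act[OF g(1), of "(C, X)"] coset_pairs_subset[OF CX]
      by (simp add: P coset_pair_act_def C'_X'_def)
    have nb: "neighbour n C' X' = D"
      using coset_pairs_subset[OF CX] by (simp add: g code_act_neighbour C'_X'_def)
    from CX' obtain a where a: "self_dual n C'" "even_code n C'" "a \<in> carrier (Lpow n)" "a \<notin> C'"
      "X' = C' #>\<^bsub>Lpow n\<^esub> a"
      by (rule coset_pairsE)
    have "{z \<in> D. qf n z = 0} \<subseteq> C' \<and> C' #>\<^bsub>Lpow n\<^esub> a = C' #>\<^bsub>Lpow n\<^esub> d"
      using L.singular_neighbour_of_odd_neighbour[OF D(1) d a(1-4)] nb a(5) by simp
    then show "P \<in> c ` N" using a by (auto simp: PC' c_def N_def)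
  next
    fix P assume "P \<in> c ` N"
    then obtain C where C: "C \<in> N" "P = c C" by blast
    then have "neighbour n C (C #>\<^bsub>Lpow n\<^esub> d) = D"
      using L.odd_neighbour_of_singular_neighbour[OF D(1) d] by (simp add: N_def)
    then show "P \<in> ?F" using image_neighbour_orbit[OF N[OF C(1)]] N[OF C(1)]
      by (auto simp: C(2) c_def QD coset_pair_classes_def orbits_def)
  qed
  obtain C1 where C1: "C1 \<in> N"
    using L.singular_neighbour_exists[OF D(1) d] by (auto simp: N_def)
  obtain C2 where C2: "N \<subseteq> {C1, C2}"
  proof -
    have "C' = C''" if "C' \<in> N - {C1}" "C'' \<in> N - {C1}" for C' C''
      using that C1 unfolding N_def
      by (intro L.at_most_two_singular_neighbours[OF D(1) d, of C1]) auto
    then consider "N - {C1} = {}" | C2 where "N - {C1} = {C2}" by blast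
    then show ?thesis
    proof cases
      case 1
      then show ?thesis by (intro that[of C1]) blast
    next
      case (2 C2)
      then show ?thesis by (intro that[of C2]) blast
    qed
  qed
  then have "c ` N = {c C1} \<or> c ` N = {c C1, c C2}" using C1 by blast
  then show ?thesis unfolding F by (elim disjE) (simp_all add: card_insert_if)
qed

section \<open>Orbits of pairs \<open>(C, E)\<close>\<close>

text \<open>Both images are the quotient of \<open>N\<close> by one and the same equivalence
  relation.\<close>

lemma bij_betw_images:
  assumes "\<And>x y. x \<in> N \<Longrightarrow> y \<in> N \<Longrightarrow> f x = f y \<longleftrightarrow> g x = g y"
  shows "\<exists>h. bij_betw h (f ` N) (g ` N)"
proof -
  have *: "g (inv_into N f (f x)) = g x" if "x \<in> N" for x
    using assms that by (metis f_inv_into_f image_eqI inv_into_into)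
  have "bij_betw (g \<circ> inv_into N f) (f ` N) (g ` N)"
  proof (rule bij_betw_imageI)
    show "inj_on (g \<circ> inv_into N f) (f ` N)"
      using * assms by (auto intro!: inj_onI)
    show "(g \<circ> inv_into N f) ` f ` N = g ` N"
      using * by (force simp: image_iff)
  qed
  then show ?thesis by blast
qed

text \<open>\<open>N\<close> is a set of normal forms meeting every orbit in \<open>A\<close>. The
  map \<open>s\<close> is compared with the actions on \<open>N\<close> alone, so it may depend on a
  fixed position of the coordinates.\<close>

lemma orbits_bij_betw:
  assumes G: "invariant_action G X \<phi>" and H: "invariant_action H Y \<psi>"
    and "A \<subseteq> X" "B \<subseteq> Y" "N \<subseteq> A" and s: "s ` N = B"
    and normal_form: "\<And>x. x \<in> A \<Longrightarrow> \<exists>g\<in>carrier G. \<phi> g x \<in> N"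
    and equiv: "\<And>x y. x \<in> N \<Longrightarrow> y \<in> N \<Longrightarrow>
      (\<exists>g\<in>carrier G. y = \<phi> g x) \<longleftrightarrow> (\<exists>h\<in>carrier H. s y = \<psi> h (s x))"
  shows "\<exists>f. bij_betw f (orbits G A \<phi>) (orbits H B \<psi>)"
proof -
  interpret G: invariant_action G X \<phi> by (rule G)
  interpret H: invariant_action H Y \<psi> by (rule H)
  have NX: "x \<in> X" if "x \<in> N" for x using that assms by blast
  have sY: "s x \<in> Y" if "x \<in> N" for x using that assms by blast
  have "orbit G \<phi> x \<in> orbit G \<phi> ` N" if x: "x \<in> A" for x
  proof -
    obtain g where g: "g \<in> carrier G" "\<phi> g x \<in> N" using normal_form[OF x] by blast
    moreover have "orbit G \<phi> (\<phi> g x) = orbit G \<phi> x" using g x \<open>A \<subseteq> X\<close> by (intro G.orbit_act) auto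
    ultimately show ?thesis by (metis image_eqI)
  qed
  then have 1: "orbits G A \<phi> = orbit G \<phi> ` N" using \<open>N \<subseteq> A\<close> unfolding orbits_def by blast
  have 2: "orbits H B \<psi> = (\<lambda>x. orbit H \<psi> (s x)) ` N" using s unfolding orbits_def by blast
  show ?thesis unfolding 1 2
    by (rule bij_betw_images) (simp add: G.orbit_eq_iff H.orbit_eq_iff NX sY equiv)
qed

text \<open>The copy of Delta on \<open>S\<close> without an enumeration of \<open>S\<close>; for
  binary words the parity of the number of ones is that of the weight.\<close>

definition Delta_on :: "nat \<Rightarrow> nat set \<Rightarrow> code" where
  "Delta_on n S = {x \<in> carrier (Lpow n).
     (\<forall>i<n. x i \<in> (if i \<in> S then {L0, L1} else {L0})) \<and> even (ewt n x)}"

lemma ewt_binary: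
  assumes "S \<subseteq> {..<n}" "\<And>i. i < n \<Longrightarrow> x i \<in> (if i \<in> S then {L0, L1} else {L0})"
  shows "ewt n x = card {i \<in> S. x i = L1}"
proof -
  have fin: "finite S" using assms(1) finite_subset by blast
  have "ewt n x = (\<Sum>i\<in>S. norm2 (x i))"
    unfolding ewt_def
  proof (rule sum.mono_neutral_right)
    show "\<forall>i\<in>{..<n} - S. norm2 (x i) = 0" using assms(2) by fastforce
  qed (use assms(1) in auto)
  also have "\<dots> = (\<Sum>i\<in>S. if x i = L1 then 1 else 0)"
  proof (rule sum.cong[OF refl])
    fix i assume "i \<in> S"
    then show "norm2 (x i) = (if x i = L1 then 1 else 0)" using assms(1) assms(2)[of i] by auto
  qed
  also have "\<dots> = card {i \<in> S. x i = L1}"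
    using fin by (simp add: sum.If_cases Int_def)
  finally show ?thesis .
qed

lemma Delta_copy_eq:
  assumes S: "S \<subseteq> {..<n}" and f: "bij_betw f {..<k} S"
  shows "{x \<in> carrier (Lpow n). (\<forall>i\<in>{..<n} - S. x i = L0) \<and> (\<lambda>j\<in>{..<k}. x (f j)) \<in> Delta k} =
    Delta_on n S"
  unfolding Delta_on_def
proof (rule Collect_cong)
  fix x
  have Sf: "S = f ` {..<k}" using f by (simp add: bij_betw_def)
  have card_eq: "card {j. j < k \<and> (\<lambda>j\<in>{..<k}. x (f j)) j = L1} = card {i \<in> S. x i = L1}"
  proof (rule bij_betw_same_card)
    have "{i \<in> S. x i = L1} = f ` {j. j < k \<and> (\<lambda>j\<in>{..<k}. x (f j)) j = L1}"
      unfolding Sf by auto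
    then show "bij_betw f {j. j < k \<and> (\<lambda>j\<in>{..<k}. x (f j)) j = L1} {i \<in> S. x i = L1}"
      using f by (intro bij_betw_subset[OF f]) auto
  qed
  have supp: "(\<forall>i\<in>{..<n} - S. x i = L0) \<and> (\<forall>j<k. x (f j) \<in> {L0, L1}) \<longleftrightarrow>
      (\<forall>i<n. x i \<in> (if i \<in> S then {L0, L1} else {L0}))"
    using S unfolding Sf by auto
  show "(x \<in> carrier (Lpow n) \<and> (\<forall>i\<in>{..<n} - S. x i = L0) \<and> (\<lambda>j\<in>{..<k}. x (f j)) \<in> Delta k) \<longleftrightarrow>
      (x \<in> carrier (Lpow n) \<and> (\<forall>i<n. x i \<in> (if i \<in> S then {L0, L1} else {L0})) \<and> even (ewt n x))"
    (is "_ \<longleftrightarrow> _ \<and> ?W \<and> _")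
  proof -
    have "?W \<Longrightarrow> even (ewt n x) \<longleftrightarrow> even (card {i \<in> S. x i = L1})"
      using ewt_binary[OF S, of x] by simp
    moreover have "(\<lambda>j\<in>{..<k}. x (f j)) \<in> Delta k \<longleftrightarrow>
        (\<forall>j<k. x (f j) \<in> {L0, L1}) \<and> even (card {j. j < k \<and> (\<lambda>j\<in>{..<k}. x (f j)) j = L1})"
      by (simp add: Delta_def carrier_Lpow)
    ultimately show ?thesis using card_eq supp by argo
  qed
qed

lemma delta_copy_iff:
  "delta_copy n k S E \<longleftrightarrow> S \<subseteq> {..<n} \<and> card S = k \<and> E = Delta_on n S"
proof
  assume "delta_copy n k S E"
  then obtain f where S: "S \<subseteq> {..<n}" "bij_betw f {..<k} S" and E: "E =
      {x \<in> carrier (Lpow n). (\<forall>i\<in>{..<n} - S. x i = L0) \<and> (\<lambda>j\<in>{..<k}. x (f j)) \<in> Delta k}"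
    unfolding delta_copy_def by blast
  show "S \<subseteq> {..<n} \<and> card S = k \<and> E = Delta_on n S"
    using S(1) bij_betw_same_card[OF S(2)] unfolding E Delta_copy_eq[OF S] by simp
next
  assume S: "S \<subseteq> {..<n} \<and> card S = k \<and> E = Delta_on n S"
  then have "finite S" using finite_subset by blast
  then obtain f where "bij_betw f {..<k} S"
    using S finite_same_card_bij[of "{..<k}" S] by auto
  then show "delta_copy n k S E" using S Delta_copy_eq[of S n f k] unfolding delta_copy_def
    by (intro conjI exI[of _ f]) auto
qed

lemma vec_act_image_apply:
  assumes "(A, \<pi>) \<in> carrier (GG n)" "x \<in> carrier (Lpow n)" "i < n"
  shows "vec_act n (A, \<pi>) x (\<pi> i) = (if \<pi> i \<in> A then conj_klein (x i) else x i)"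
proof -
  have p: "\<pi> permutes {..<n}" using assms(1) by (auto simp: GG_def)
  then have "\<pi> i < n" using permutes_in_image[OF p, of i] assms(3) by simp
  then show ?thesis using assms(2) by (simp add: vec_act_apply permutes_inverses[OF p])
qed

lemma conj_klein_eq_iff:
  "conj_klein a = L0 \<longleftrightarrow> a = L0" "conj_klein a = L1 \<longleftrightarrow> a = L1"
  by (cases a; simp)+

text \<open>Conjugation fixes \<open>L0\<close> and \<open>L1\<close>, so only the permutation part
  of \<open>g\<close> is felt.\<close>

lemma code_act_Delta_on:
  assumes g: "g \<in> carrier (GG n)"
  shows "code_act n g (Delta_on n S) = Delta_on n (snd g ` S)"
proof -
  obtain A \<pi> where gA: "g = (A, \<pi>)" and p: "\<pi> permutes {..<n}" using g by (auto simp: GG_def)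
  have iff: "vec_act n g x \<in> Delta_on n (\<pi> ` S) \<longleftrightarrow> x \<in> Delta_on n S" if x: "x \<in> carrier (Lpow n)" for x
  proof -
    have "(\<forall>i<n. vec_act n g x i \<in> (if i \<in> \<pi> ` S then {L0, L1} else {L0})) \<longleftrightarrow>
        (\<forall>i\<in>\<pi> ` {..<n}. vec_act n g x i \<in> (if i \<in> \<pi> ` S then {L0, L1} else {L0}))"
      by (simp add: permutes_image[OF p] Ball_def)
    also have "\<dots> \<longleftrightarrow> (\<forall>i<n. x i \<in> (if i \<in> S then {L0, L1} else {L0}))"
      using g x unfolding gA ball_simps
      by (auto simp: vec_act_image_apply inj_image_mem_iff[OF permutes_inj[OF p]] conj_klein_eq_iff)
    finally show ?thesis using x vec_act_closed[OF x] by (simp add: Delta_on_def ewt_vec_act[OF g])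
  qed
  have "vec_act n g ` Delta_on n S = Delta_on n (\<pi> ` S)"
  proof (intro equalityI subsetI)
    fix z assume "z \<in> vec_act n g ` Delta_on n S"
    then obtain x where "x \<in> Delta_on n S" "z = vec_act n g x" by blast
    then show "z \<in> Delta_on n (\<pi> ` S)" using iff[of x] by (simp add: Delta_on_def)
  next
    fix z assume z: "z \<in> Delta_on n (\<pi> ` S)"
    then have "z \<in> vec_act n g ` carrier (Lpow n)"
      using bij_betw_vec_act[OF g] by (simp add: Delta_on_def bij_betw_def)
    then obtain x where "x \<in> carrier (Lpow n)" "z = vec_act n g x" by blast
    then show "z \<in> vec_act n g ` Delta_on n S" using iff[of x] z by simp
  qed
  then show ?thesis by (simp add: gA code_act_def)
qed

interpretation delta_pair: invariant_action "GG n"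
  "Pow (carrier (Lpow n)) \<times> UNIV \<times> Pow (carrier (Lpow n))" "delta_pair_act n" for n
proof (intro invariant_action.intro group_GG invariant_action_axioms.intro)
  let ?X = "Pow (carrier (Lpow n)) \<times> (UNIV :: nat set set) \<times> Pow (carrier (Lpow n))"
  show "delta_pair_act n g P \<in> ?X" if "g \<in> carrier (GG n)" "P \<in> ?X" for g P
    using that by (auto simp: delta_pair_act_def dest: code_act_subset[THEN subsetD, rotated])
  show "delta_pair_act n (g \<otimes>\<^bsub>GG n\<^esub> h) P = delta_pair_act n g (delta_pair_act n h P)"
    if "g \<in> carrier (GG n)" "h \<in> carrier (GG n)" "P \<in> ?X" for g h P
  proof -
    have "snd (g \<otimes>\<^bsub>GG n\<^esub> h) = snd g \<circ> snd h" by (simp add: GG_def split: prod.splits)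
    then show ?thesis using that by (auto simp: delta_pair_act_def code.act_mult)
  qed
  show "delta_pair_act n \<one>\<^bsub>GG n\<^esub> P = P" if "P \<in> ?X" for P
  proof -
    have "snd \<one>\<^bsub>GG n\<^esub> = id" by (simp add: GG_def)
    then show ?thesis using that by (auto simp: delta_pair_act_def code.act_one)
  qed
qed

lemma delta_pairs_iff:
  "(C, S, E) \<in> delta_pairs n k \<longleftrightarrow> self_dual n C \<and> even_code n C \<and> S \<subseteq> {..<n} \<and> card S = k \<and>
    E = Delta_on n S \<and> Delta_on n S \<subseteq> C"
  by (auto simp: delta_pairs_def delta_copy_iff)

lemma delta_pairs_closed:
  assumes "(C, S, E) \<in> delta_pairs n k" and g: "g \<in> carrier (GG n)"
  shows "(code_act n g C, snd g ` S, code_act n g E) \<in> delta_pairs n k"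
proof -
  have C: "self_dual n C" "even_code n C" "S \<subseteq> {..<n}" "card S = k" "E = Delta_on n S" "E \<subseteq> C"
    using assms(1) by (auto simp: delta_pairs_iff)
  have p: "snd g permutes {..<n}" using g by (auto simp: GG_def)
  have "code_act n g E = Delta_on n (snd g ` S)" by (simp add: C(5) code_act_Delta_on[OF g])
  moreover have "code_act n g E \<subseteq> code_act n g C" using C(6) by (auto simp: code_act_def)
  moreover have "snd g ` S \<subseteq> {..<n}" using C(3) permutes_image[OF p] by blast
  moreover have "card (snd g ` S) = k" using C(4) card_image[OF permutes_inj_on[OF p]] by simp
  ultimately show ?thesis
    using C by (simp add: delta_pairs_iff code_act_self_dual[OF g] code_act_even[OF g self_dual_subset])
qed

lemma permutes_moving_subset:
  assumes "finite T" "S \<subseteq> T" "S' \<subseteq> T" "card S = card S'"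
  obtains \<pi> where "\<pi> permutes T" "\<pi> ` S = S'"
proof -
  have fin: "finite S" "finite S'" using assms finite_subset by blast+
  obtain f where f: "bij_betw f S S'" using finite_same_card_bij[OF fin assms(4)] by blast
  have "card (T - S) = card (T - S')" using assms fin by (simp add: card_Diff_subset)
  then obtain h where h: "bij_betw h (T - S) (T - S')"
    using finite_same_card_bij[of "T - S" "T - S'"] assms(1) by blast
  define \<pi> where "\<pi> i = (if i \<in> S then f i else if i \<in> T then h i else i)" for i
  have 1: "bij_betw \<pi> S S'" using f by (rule bij_betw_cong[THEN iffD1, rotated]) (simp add: \<pi>_def)
  have "bij_betw \<pi> (T - S) (T - S')"
    using h by (rule bij_betw_cong[THEN iffD1, rotated]) (simp add: \<pi>_def)
  then have "bij_betw \<pi> (S \<union> (T - S)) (S' \<union> (T - S'))" using 1 by (intro bij_betw_combine) auto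
  moreover have "S \<union> (T - S) = T" "S' \<union> (T - S') = T" using assms by auto
  ultimately have "\<pi> permutes T" using assms by (intro bij_imp_permutes) (auto simp: \<pi>_def)
  moreover have "\<pi> ` S = S'" using 1 by (simp add: bij_betw_def)
  ultimately show ?thesis by (rule that)
qed

section \<open>Shortening and lengthening\<close>

text \<open>For words of length \<open>n\<close> this is orthogonality to the unit vectors at the
  coordinates from \<open>m\<close> on, since \<open>dot a L1 = 0\<close> exactly for
  \<open>a\<close> in \<open>{L0, L1}\<close>.\<close>

definition binary_from :: "nat \<Rightarrow> nat \<Rightarrow> (nat \<Rightarrow> klein) \<Rightarrow> bool" where
  "binary_from n m z \<longleftrightarrow> (\<forall>i\<in>{m..<n}. z i \<in> {L0, L1})"

definition shorten :: "nat \<Rightarrow> nat \<Rightarrow> code \<Rightarrow> code" where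
  "shorten n m C = (\<lambda>z. restrict z {..<m}) ` {z \<in> C. binary_from n m z}"

text \<open>The direct sum of \<open>D\<close> with the code of all binary words of length
  \<open>n - m\<close>, which is self-dual, and non-even for \<open>m < n\<close>.\<close>

definition lengthen :: "nat \<Rightarrow> nat \<Rightarrow> code \<Rightarrow> code" where
  "lengthen n m D = {z \<in> carrier (Lpow n). binary_from n m z \<and> restrict z {..<m} \<in> D}"

definition unit_vec :: "nat \<Rightarrow> nat \<Rightarrow> nat \<Rightarrow> klein" where
  "unit_vec n i = (\<lambda>j\<in>{..<n}. if j = i then L1 else L0)"

definition zero_extend :: "nat \<Rightarrow> nat \<Rightarrow> (nat \<Rightarrow> klein) \<Rightarrow> nat \<Rightarrow> klein" where
  "zero_extend n m y = (\<lambda>i\<in>{..<n}. if i < m then y i else L0)"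

lemma klein_add_binary: "a \<in> {L0, L1} \<Longrightarrow> b \<in> {L0, L1} \<Longrightarrow> klein_add a b \<in> {L0, L1}"
  by auto

lemma binary_from_mult:
  "binary_from n m x \<Longrightarrow> binary_from n m y \<Longrightarrow> binary_from n m (x \<otimes>\<^bsub>Lpow n\<^esub> y)"
  using klein_add_binary by (simp add: binary_from_def Lpow_mult)

lemma restrict_mult:
  "m \<le> n \<Longrightarrow> restrict (x \<otimes>\<^bsub>Lpow n\<^esub> y) {..<m} = restrict x {..<m} \<otimes>\<^bsub>Lpow m\<^esub> restrict y {..<m}"
  by (auto simp: Lpow_mult fun_eq_iff)

lemma restrict_carrier: "restrict x {..<m} \<in> carrier (Lpow m)"
  by (simp add: carrier_Lpow)

lemma zero_extend_carrier: "zero_extend n m y \<in> carrier (Lpow n)"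
  by (simp add: carrier_Lpow zero_extend_def)

lemma restrict_zero_extend:
  "m \<le> n \<Longrightarrow> y \<in> carrier (Lpow m) \<Longrightarrow> restrict (zero_extend n m y) {..<m} = y"
  by (auto simp: zero_extend_def carrier_Lpow fun_eq_iff PiE_iff extensional_def)

lemma zero_extend_in_lengthen:
  "m \<le> n \<Longrightarrow> y \<in> carrier (Lpow m) \<Longrightarrow> zero_extend n m y \<in> lengthen n m D \<longleftrightarrow> y \<in> D"
  by (simp add: lengthen_def zero_extend_carrier restrict_zero_extend binary_from_def) (simp add: zero_extend_def)

lemma unit_vec_carrier: "unit_vec n i \<in> carrier (Lpow n)"
  by (simp add: carrier_Lpow unit_vec_def)

lemma restrict_unit_vec: "m \<le> i \<Longrightarrow> m \<le> n \<Longrightarrow> restrict (unit_vec n i) {..<m} = \<one>\<^bsub>Lpow m\<^esub>"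
  by (auto simp: unit_vec_def Lpow_one fun_eq_iff)

lemma binary_from_unit_vec: "binary_from n m (unit_vec n i)"
  by (simp add: binary_from_def unit_vec_def)

lemma unit_vec_in_lengthen: "\<one>\<^bsub>Lpow m\<^esub> \<in> D \<Longrightarrow> m \<le> i \<Longrightarrow> m \<le> n \<Longrightarrow> unit_vec n i \<in> lengthen n m D"
  by (simp add: lengthen_def unit_vec_carrier binary_from_unit_vec restrict_unit_vec)

lemma ewt_unit_vec: "i < n \<Longrightarrow> ewt n (unit_vec n i) = 1"
proof -
  assume "i < n"
  have "ewt n (unit_vec n i) = (\<Sum>j<n. if j = i then 1 else 0)"
    unfolding ewt_def by (rule sum.cong) (simp_all add: unit_vec_def)
  then show ?thesis using \<open>i < n\<close> by simp
qed

lemma qf_unit_vec: "i < n \<Longrightarrow> qf n (unit_vec n i) = 1"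
  by (simp add: qf_def ewt_unit_vec)

lemma dot_L1_eq_0_iff: "dot a L1 = 0 \<longleftrightarrow> a \<in> {L0, L1}"
  by (cases a) (simp_all add: dot_def)

lemma ip_unit_vec: "i < n \<Longrightarrow> ip n z (unit_vec n i) = dot (z i) L1"
proof -
  assume "i < n"
  have "ip n z (unit_vec n i) = (\<Sum>j<n. if j = i then dot (z i) L1 else 0)"
    unfolding ip_def by (rule sum.cong) (simp_all add: unit_vec_def dot_def)
  also have "\<dots> = dot (z i) L1" by (subst sum.delta) (simp_all add: \<open>i < n\<close>)
  finally show ?thesis .
qed

lemma ip_unit_vec_eq_0_iff: "i < n \<Longrightarrow> ip n z (unit_vec n i) = 0 \<longleftrightarrow> z i \<in> {L0, L1}"
  using ip_unit_vec dot_L1_eq_0_iff by metis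

lemma ip_binary_from:
  assumes "m \<le> n" "binary_from n m z" "binary_from n m w"
  shows "ip n z w = ip m (restrict z {..<m}) (restrict w {..<m})"
proof -
  have "ip n z w = (\<Sum>i<m. dot (z i) (w i))"
    unfolding ip_def
  proof (rule sum.mono_neutral_right)
    show "\<forall>i\<in>{..<n} - {..<m}. dot (z i) (w i) = 0"
    proof
      fix i assume "i \<in> {..<n} - {..<m}"
      then have "i \<in> {m..<n}" by auto
      then have "z i \<in> {L0, L1}" "w i \<in> {L0, L1}" using assms(2,3) unfolding binary_from_def by blast+
      then show "dot (z i) (w i) = 0" by (auto simp: dot_def)
    qed
  qed (use assms(1) in auto)
  then show ?thesis by (simp add: ip_def)
qed

text \<open>The zero word in \<open>D\<close> brings the tail unit vectors into the lengthened code,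
  and they force binary tails. Between words with binary tails the tail contributes nothing to the
  inner product, so the condition descends to length \<open>m\<close>.\<close>

lemma orthogonal_lengthen:
  assumes D: "D \<subseteq> carrier (Lpow m)" "\<one>\<^bsub>Lpow m\<^esub> \<in> D" and mn: "m \<le> n"
  shows "{z \<in> carrier (Lpow n). \<forall>y\<in>lengthen n m D. ip n z y = 0} =
    lengthen n m {z \<in> carrier (Lpow m). \<forall>y\<in>D. ip m z y = 0}"
proof (intro equalityI subsetI)
  fix z assume "z \<in> {z \<in> carrier (Lpow n). \<forall>y\<in>lengthen n m D. ip n z y = 0}"
  then have z: "z \<in> carrier (Lpow n)" and orth: "\<And>y. y \<in> lengthen n m D \<Longrightarrow> ip n z y = 0" by auto
  have bin: "binary_from n m z"
    unfolding binary_from_def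
  proof
    fix i assume "i \<in> {m..<n}"
    then show "z i \<in> {L0, L1}"
      using orth[OF unit_vec_in_lengthen[OF D(2) _ mn, of i]] ip_unit_vec_eq_0_iff[of i n z] by simp
  qed
  have "ip m (restrict z {..<m}) y = 0" if y: "y \<in> D" for y
  proof -
    have yc: "y \<in> carrier (Lpow m)" using y D by blast
    have e: "zero_extend n m y \<in> lengthen n m D" using zero_extend_in_lengthen[OF mn yc] y by blast
    then have "ip n z (zero_extend n m y) = ip m (restrict z {..<m}) (restrict (zero_extend n m y) {..<m})"
      by (intro ip_binary_from[OF mn bin]) (simp add: lengthen_def)
    then show ?thesis using orth[OF e] restrict_zero_extend[OF mn yc] by simp
  qed
  then show "z \<in> lengthen n m {z \<in> carrier (Lpow m). \<forall>y\<in>D. ip m z y = 0}"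
    using z bin restrict_carrier by (simp add: lengthen_def)
next
  fix z assume "z \<in> lengthen n m {z \<in> carrier (Lpow m). \<forall>y\<in>D. ip m z y = 0}"
  then show "z \<in> {z \<in> carrier (Lpow n). \<forall>y\<in>lengthen n m D. ip n z y = 0}"
    using ip_binary_from[OF mn] by (auto simp: lengthen_def)
qed

lemma lengthen_inject:
  assumes "m \<le> n" "D \<subseteq> carrier (Lpow m)" "D' \<subseteq> carrier (Lpow m)" "lengthen n m D = lengthen n m D'"
  shows "D = D'"
proof -
  have "y \<in> D \<longleftrightarrow> y \<in> D'" if "y \<in> carrier (Lpow m)" for y
    using zero_extend_in_lengthen[OF assms(1) that] assms(4) by metis
  then show ?thesis using assms(2,3) by blast
qed

lemma self_dual_one: "self_dual n C \<Longrightarrow> \<one>\<^bsub>Lpow n\<^esub> \<in> C"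
  using L.lagrangian_subgroup subgroup.one_closed by blast

text \<open>Either side puts the zero word into \<open>D\<close>; then self-duality upstairs is an
  equality of two lengthened codes, and lengthening is injective.\<close>

lemma self_dual_lengthen_iff:
  assumes D: "D \<subseteq> carrier (Lpow m)" and mn: "m \<le> n"
  shows "self_dual n (lengthen n m D) \<longleftrightarrow> self_dual m D"
proof -
  let ?D' = "{z \<in> carrier (Lpow m). \<forall>y\<in>D. ip m z y = 0}"
  have one: "restrict \<one>\<^bsub>Lpow n\<^esub> {..<m} = \<one>\<^bsub>Lpow m\<^esub>" using mn by (auto simp: Lpow_one fun_eq_iff)
  have "self_dual n (lengthen n m D) \<longleftrightarrow> lengthen n m D = lengthen n m ?D'" if "\<one>\<^bsub>Lpow m\<^esub> \<in> D"
    unfolding L.lagrangian_def orthogonal_lengthen[OF D that mn] ..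
  also have "lengthen n m D = lengthen n m ?D' \<longleftrightarrow> self_dual m D"
    unfolding L.lagrangian_def using lengthen_inject[OF mn D, of ?D'] by auto
  finally have "self_dual n (lengthen n m D) \<longleftrightarrow> self_dual m D" if "\<one>\<^bsub>Lpow m\<^esub> \<in> D" using that .
  moreover have "\<one>\<^bsub>Lpow m\<^esub> \<in> D" if "self_dual n (lengthen n m D)"
    using self_dual_one[OF that] by (simp add: lengthen_def one)
  moreover have "\<one>\<^bsub>Lpow m\<^esub> \<in> D" if "self_dual m D" by (rule self_dual_one[OF that])
  ultimately show ?thesis by blast
qed

lemma shorten_subset: "shorten n m C \<subseteq> carrier (Lpow m)"
  using restrict_carrier by (auto simp: shorten_def)

lemma Delta_on_tail_iff:
  assumes "m \<le> n"
  shows "x \<in> Delta_on n {m..<n} \<longleftrightarrow> x \<in> carrier (Lpow n) \<and> binary_from n m x \<and>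
    restrict x {..<m} = \<one>\<^bsub>Lpow m\<^esub> \<and> qf n x = 0"
proof -
  have "(\<forall>i<n. x i \<in> (if i \<in> {m..<n} then {L0, L1} else {L0})) \<longleftrightarrow>
      binary_from n m x \<and> (\<forall>i<m. x i = L0)" (is "?L \<longleftrightarrow> ?R")
  proof
    assume L: ?L
    have "x i \<in> {L0, L1}" if "i \<in> {m..<n}" for i using L[rule_format, of i] that by simp
    moreover have "x i = L0" if "i < m" for i using L[rule_format, of i] that assms by simp
    ultimately show ?R unfolding binary_from_def by blast
  next
    assume R: ?R
    show ?L
    proof (intro allI impI)
      fix i assume "i < n"
      then show "x i \<in> (if i \<in> {m..<n} then {L0, L1} else {L0})"
        using R unfolding binary_from_def by (cases "i < m") simp_all
    qed
  qed
  moreover have "restrict x {..<m} = \<one>\<^bsub>Lpow m\<^esub> \<longleftrightarrow> (\<forall>i<m. x i = L0)"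
    by (auto simp: Lpow_one fun_eq_iff restrict_def)
  ultimately show ?thesis unfolding Delta_on_def by (auto simp: qf_eq_0_iff)
qed

section \<open>Even self-dual codes containing Delta on the last coordinates\<close>

context
  fixes n m C
  assumes mn: "m < n" and C: "self_dual n C" "even_code n C" "Delta_on n {m..<n} \<subseteq> C"
begin

interpretation C: subgroup C "Lpow n"
  by (rule L.lagrangian_subgroup[OF C(1)])

lemma unit_vec_notin: "unit_vec n m \<notin> C"
  using C(2) ewt_unit_vec[OF mn] by (auto simp: even_code_def)

text \<open>Delta contains the sum of the unit vectors at \<open>m\<close> and at any other tail
  coordinate. A word of \<open>C\<close> is orthogonal to these sums, so it pairs equally with all
  tail unit vectors and one coordinate decides for the whole tail.\<close>

lemma binary_from_iff_ip:
  assumes z: "z \<in> C"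
  shows "binary_from n m z \<longleftrightarrow> ip n z (unit_vec n m) = 0"
proof
  assume "binary_from n m z"
  then show "ip n z (unit_vec n m) = 0"
    using mn by (simp only: ip_unit_vec_eq_0_iff binary_from_def) simp
next
  assume zm: "ip n z (unit_vec n m) = 0"
  show "binary_from n m z"
    unfolding binary_from_def
  proof
    fix i assume i: "i \<in> {m..<n}"
    have "unit_vec n m \<otimes>\<^bsub>Lpow n\<^esub> unit_vec n i \<in> Delta_on n {m..<n}" if "i \<noteq> m"
      using i that mn
      by (auto simp: Delta_on_tail_iff unit_vec_carrier binary_from_mult binary_from_unit_vec
          restrict_mult restrict_unit_vec L.q_mult qf_unit_vec ip_unit_vec L.m_closed)
        (simp_all add: unit_vec_def dot_def)
    then have "ip n z (unit_vec n m \<otimes>\<^bsub>Lpow n\<^esub> unit_vec n i) = 0" if "i \<noteq> m"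
      using L.lagrangian_B[OF C(1) z] C(3) that by blast
    then have "ip n z (unit_vec n i) = 0"
      using zm L.lagrangian_carrier[OF C(1) z] by (cases "i = m") (simp_all add: L.B_mult_right unit_vec_carrier)
    then show "z i \<in> {L0, L1}" using i by (simp only: ip_unit_vec_eq_0_iff atLeastLessThan_iff)
  qed
qed

text \<open>By the test at the single coordinate \<open>m\<close>, the even half of the neighbour
  consists of the words of \<open>C\<close> with binary tail. The odd half is its translate by the
  unit vector and supplies the tails of the other parity.\<close>

lemma neighbour_unit_vec_eq_lengthen:
  "neighbour n C (C #>\<^bsub>Lpow n\<^esub> unit_vec n m) = lengthen n m (shorten n m C)"
proof -
  let ?u = "unit_vec n m"
  let ?T = "neighbour n C (C #>\<^bsub>Lpow n\<^esub> ?u)"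
  have u: "?u \<in> carrier (Lpow n)" "?u \<in> C #>\<^bsub>Lpow n\<^esub> ?u" "qf n ?u = 1"
    using unit_vec_carrier L.rcos_self[OF _ C.subgroup_axioms] qf_unit_vec[OF mn] by auto
  have T: "z \<in> ?T \<longleftrightarrow> z \<in> C \<and> binary_from n m z \<or> z \<otimes>\<^bsub>Lpow n\<^esub> ?u \<in> C \<and> binary_from n m (z \<otimes>\<^bsub>Lpow n\<^esub> ?u)"
    if z: "z \<in> carrier (Lpow n)" for z
  proof -
    have "z \<in> C #>\<^bsub>Lpow n\<^esub> ?u \<and> qf n z = 1 \<longleftrightarrow> z \<otimes>\<^bsub>Lpow n\<^esub> ?u \<in> C \<and> binary_from n m (z \<otimes>\<^bsub>Lpow n\<^esub> ?u)"
      using L.coset_diff_iff[OF C(1,2) u(1) unit_vec_notin u(2,3) z] binary_from_iff_ip by blast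
    moreover have "(\<forall>x\<in>C #>\<^bsub>Lpow n\<^esub> ?u. ip n z x = 0) \<longleftrightarrow> binary_from n m z" if "z \<in> C"
      using L.coset_orthogonal_eq[OF C(1,2) u(1) unit_vec_notin that _ u(2)] u(2)
        binary_from_iff_ip[OF that] by metis
    ultimately show ?thesis unfolding L.odd_neighbour_def by blast
  qed
  have ru: "restrict ?u {..<m} = \<one>\<^bsub>Lpow m\<^esub>" using mn by (simp add: restrict_unit_vec)
  show ?thesis
  proof (intro equalityI subsetI)
    fix z assume zT: "z \<in> ?T"
    then have z: "z \<in> carrier (Lpow n)"
      using C.subset L.coset_carrier[OF C(1,2) u(1) unit_vec_notin] unfolding L.odd_neighbour_def by blast
    show "z \<in> lengthen n m (shorten n m C)"
    proof (cases "z \<in> C \<and> binary_from n m z")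
      case True
      then show ?thesis using z by (auto simp: lengthen_def shorten_def)
    next
      case False
      then have zu: "z \<otimes>\<^bsub>Lpow n\<^esub> ?u \<in> C" "binary_from n m (z \<otimes>\<^bsub>Lpow n\<^esub> ?u)" using T[OF z] zT by auto
      have "z = z \<otimes>\<^bsub>Lpow n\<^esub> ?u \<otimes>\<^bsub>Lpow n\<^esub> ?u" using z u by (simp add: L.mult_cancel_right)
      then have "binary_from n m z" using binary_from_mult[OF zu(2) binary_from_unit_vec, of m] by simp
      moreover have "restrict z {..<m} = restrict (z \<otimes>\<^bsub>Lpow n\<^esub> ?u) {..<m}"
        using mn ru restrict_carrier by (simp add: restrict_mult)
      ultimately show ?thesis using z zu by (auto simp: lengthen_def shorten_def)
    qed
  next
    fix z assume "z \<in> lengthen n m (shorten n m C)"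
    then obtain c where z: "z \<in> carrier (Lpow n)" "binary_from n m z"
      and c: "c \<in> C" "binary_from n m c" "restrict z {..<m} = restrict c {..<m}"
      by (auto simp: lengthen_def shorten_def)
    have cc: "c \<in> carrier (Lpow n)" using c by simp
    \<comment> \<open>\<open>?w\<close> is a binary word supported on the tail: it lies in Delta if
      it is even, and after adding \<open>?u\<close> if it is odd.\<close>
    let ?w = "z \<otimes>\<^bsub>Lpow n\<^esub> c"
    have w: "?w \<in> carrier (Lpow n)" "binary_from n m ?w" "restrict ?w {..<m} = \<one>\<^bsub>Lpow m\<^esub>"
      using z c cc mn restrict_carrier by (simp_all add: binary_from_mult restrict_mult L.mult_self)
    show "z \<in> ?T"
    proof (cases "qf n ?w = 0")
      case True
      then have "?w \<in> C" using w C(3) mn Delta_on_tail_iff[of m n ?w] by auto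
      then have "z \<in> C" using L.subgroup_mult_iff[OF C.subgroup_axioms c(1) z(1)] z cc
        by (simp add: L.m_comm)
      then show ?thesis using T[OF z(1)] z by blast
    next
      case False
      have "ip n ?w ?u = 0" using w(2) mn by (simp only: ip_unit_vec_eq_0_iff binary_from_def) simp
      then have "?w \<otimes>\<^bsub>Lpow n\<^esub> ?u \<in> Delta_on n {m..<n}"
        using w u mn ru False
        by (simp add: Delta_on_tail_iff binary_from_mult binary_from_unit_vec restrict_mult L.q_mult)
      then have "c \<otimes>\<^bsub>Lpow n\<^esub> (?w \<otimes>\<^bsub>Lpow n\<^esub> ?u) \<in> C" using C(3) c by auto
      moreover have "c \<otimes>\<^bsub>Lpow n\<^esub> (?w \<otimes>\<^bsub>Lpow n\<^esub> ?u) = z \<otimes>\<^bsub>Lpow n\<^esub> ?u"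
        using z cc u by (simp add: L.m_comm[of z] L.m_assoc L.mult_cancel)
      moreover have "binary_from n m (z \<otimes>\<^bsub>Lpow n\<^esub> ?u)"
        using z by (simp add: binary_from_mult binary_from_unit_vec)
      ultimately show ?thesis using T[OF z(1)] by simp
    qed
  qed
qed

lemma lengthen_shorten_self_dual: "self_dual n (lengthen n m (shorten n m C))"
  using L.odd_neighbour_lagrangian[OF C(1,2) unit_vec_carrier unit_vec_notin]
  by (simp add: neighbour_unit_vec_eq_lengthen)

lemma shorten_self_dual: "self_dual m (shorten n m C)"
  using lengthen_shorten_self_dual self_dual_lengthen_iff[OF shorten_subset] mn by simp

lemma lengthen_shorten_singular_part: "{z \<in> lengthen n m (shorten n m C). qf n z = 0} \<subseteq> C"
  by (auto simp: L.odd_neighbour_def simp flip: neighbour_unit_vec_eq_lengthen)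

end

text \<open>Any even neighbour of the lengthened code works: Delta on the tail consists of even
  words of that code, and the odd neighbour taken at \<open>?u\<close> recovers the lengthened code,
  hence \<open>D\<close>.\<close>

lemma self_dual_is_shortened:
  assumes D: "self_dual m D" and mn: "m < n"
  shows "\<exists>C. self_dual n C \<and> even_code n C \<and> Delta_on n {m..<n} \<subseteq> C \<and> shorten n m C = D"
proof -
  let ?u = "unit_vec n m"
  have T: "self_dual n (lengthen n m D)" using D mn by (simp add: self_dual_lengthen_iff self_dual_subset)
  have u: "?u \<in> lengthen n m D" "qf n ?u = 1"
    using self_dual_one[OF D] mn by (simp_all add: unit_vec_in_lengthen qf_unit_vec)
  obtain C where C: "self_dual n C" "even_code n C" "{z \<in> lengthen n m D. qf n z = 0} \<subseteq> C"
    using L.singular_neighbour_exists[OF T u] by blast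
  have "Delta_on n {m..<n} \<subseteq> {z \<in> lengthen n m D. qf n z = 0}"
    using self_dual_one[OF D] mn by (auto simp: Delta_on_tail_iff lengthen_def)
  then have E: "Delta_on n {m..<n} \<subseteq> C" using C by blast
  have "lengthen n m (shorten n m C) = lengthen n m D"
    using L.odd_neighbour_of_singular_neighbour[OF T u C] neighbour_unit_vec_eq_lengthen[OF mn C(1,2) E]
    by simp
  then have "shorten n m C = D"
    by (rule lengthen_inject[OF less_imp_le[OF mn] shorten_subset self_dual_subset[OF D]])
  with C E show ?thesis by blast
qed

text \<open>
  The conjugation at coordinate \<open>m\<close> is the reflection in the unit vector there, so it exchanges
  the two even neighbours of the extended code.
\<close>

lemma shorten_eq_cases:
  assumes mn: "m < n"
    and C: "self_dual n C" "even_code n C" "Delta_on n {m..<n} \<subseteq> C"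
    and C': "self_dual n C'" "even_code n C'" "Delta_on n {m..<n} \<subseteq> C'"
    and eq: "shorten n m C = shorten n m C'"
  shows "C' = C \<or> C' = code_act n ({m}, id) C"
proof (cases "C = C'")
  case False
  let ?u = "unit_vec n m" and ?T = "lengthen n m (shorten n m C)"
  have h: "({m}, id) \<in> carrier (GG n)" using mn by (simp add: GG_def permutes_id)
  have T: "self_dual n ?T" by (rule lengthen_shorten_self_dual[OF mn C])
  have "\<one>\<^bsub>Lpow m\<^esub> \<in> shorten n m C" by (rule self_dual_one[OF shorten_self_dual[OF mn C]])
  then have u: "?u \<in> ?T" "qf n ?u = 1" using mn by (simp_all add: unit_vec_in_lengthen qf_unit_vec)
  have T0: "{z \<in> ?T. qf n z = 0} \<subseteq> C" "{z \<in> ?T. qf n z = 0} \<subseteq> C'"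
    using lengthen_shorten_singular_part[OF mn C] lengthen_shorten_singular_part[OF mn C'] eq by auto
  \<comment> \<open>Both codes are self-dual, so one inclusion gives equality. Words of
    \<open>C\<close> binary at \<open>m\<close> are fixed and belong to the even part of
    \<open>?T\<close>, which lies in both codes; the others are translated by \<open>?u\<close>,
    which is the passage to the other even neighbour.\<close>
  have "code_act n ({m}, id) C \<subseteq> C'"
  proof
    fix w assume "w \<in> code_act n ({m}, id) C"
    then obtain z where z: "z \<in> C" and w: "w = vec_act n ({m}, id) z" by (auto simp: code_act_def)
    have zc: "z \<in> carrier (Lpow n)" using self_dual_subset[OF C(1)] z by blast
    have w_apply: "w = (\<lambda>i\<in>{..<n}. if i = m then conj_klein (z i) else z i)"
      using zc by (simp add: w vec_act_apply cong: if_cong)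
    show "w \<in> C'"
    proof (cases "z m \<in> {L0, L1}")
      case True
      then have "w = z" using zc by (auto simp: w_apply carrier_Lpow fun_eq_iff PiE_iff extensional_def)
      have "ip n z ?u = 0" using True ip_unit_vec_eq_0_iff[OF mn] by blast
      then have "binary_from n m z" using binary_from_iff_ip[OF mn C z] by simp
      then have "z \<in> ?T" using z zc by (auto simp: lengthen_def shorten_def)
      moreover have "qf n z = 0" using z C(2) by (simp add: even_code_def qf_eq_0_iff)
      ultimately show ?thesis using T0(2) \<open>w = z\<close> by blast
    next
      case False
      then have "z \<notin> ?T" using mn by (auto simp: lengthen_def binary_from_def)
      then have "z \<otimes>\<^bsub>Lpow n\<^esub> ?u \<in> C'"
        using L.other_singular_neighbour[OF T u C(1,2) T0(1) C'(1,2) T0(2) \<open>C \<noteq> C'\<close> z] by blast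
      moreover have "w = z \<otimes>\<^bsub>Lpow n\<^esub> ?u"
        unfolding w_apply Lpow_mult
      proof (rule restrict_ext)
        fix i assume "i \<in> {..<n}"
        moreover have "conj_klein (z m) = klein_add (z m) L1" using False by (cases "z m") simp_all
        moreover have "klein_add a L0 = a" for a by (cases a) simp_all
        ultimately show "(if i = m then conj_klein (z i) else z i) = klein_add (z i) (?u i)"
          by (simp add: unit_vec_def)
      qed
      ultimately show ?thesis by simp
    qed
  qed
  then have "code_act n ({m}, id) C = C'"
    by (rule L.lagrangian_subset_eq[OF code_act_self_dual[OF h C(1)] C'(1)])
  then show ?thesis by simp
qed simp

text \<open>The restriction of a group element to the first \<open>m\<close> coordinates, meaningful
  when it preserves the tail. The permutation is set to the identity beyond \<open>m\<close>, as
  \<open>permutes\<close> demands.\<close>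

definition cut :: "nat \<Rightarrow> nat set \<times> (nat \<Rightarrow> nat) \<Rightarrow> nat set \<times> (nat \<Rightarrow> nat)" where
  "cut m g = (fst g \<inter> {..<m}, \<lambda>i. if i < m then snd g i else i)"

context
  fixes n m g
  assumes mn: "m \<le> n" and g: "g \<in> carrier (GG n)" and tail: "snd g ` {m..<n} = {m..<n}"
begin

lemma perm: "snd g permutes {..<n}"
  using g by (auto simp: GG_def)

lemma snd_less_iff: "snd g i < m \<longleftrightarrow> i < m"
proof (cases "i < n")
  case True
  have "snd g i \<in> {m..<n} \<longleftrightarrow> i \<in> {m..<n}"
    using inj_image_mem_iff[OF permutes_inj[OF perm], of i "{m..<n}"] tail by simp
  moreover have "snd g i < n" using permutes_in_image[OF perm, of i] True by simp
  ultimately show ?thesis using True by auto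
next
  case False
  then show ?thesis using permutes_not_in[OF perm, of i] by simp
qed

lemma snd_cut_permutes: "snd (cut m g) permutes {..<m}"
proof (rule bij_imp_permutes)
  have inj: "inj_on (snd (cut m g)) {..<m}"
    using permutes_inj[OF perm] by (auto simp: cut_def inj_on_def dest: injD)
  moreover have "snd (cut m g) ` {..<m} \<subseteq> {..<m}" by (auto simp: cut_def snd_less_iff)
  ultimately show "bij_betw (snd (cut m g)) {..<m} {..<m}"
    by (simp add: bij_betw_def endo_inj_surj)
qed (simp add: cut_def)

lemma cut_closed: "cut m g \<in> carrier (GG m)"
  using snd_cut_permutes by (simp add: GG_def cut_def)

lemma inv_cut:
  assumes "i < m"
  shows "Hilbert_Choice.inv (snd (cut m g)) i = Hilbert_Choice.inv (snd g) i"
proof -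
  let ?j = "Hilbert_Choice.inv (snd g) i"
  have "snd g ?j = i" by (rule permutes_inverses[OF perm])
  then have "snd (cut m g) ?j = i" using assms snd_less_iff[of ?j] by (simp add: cut_def)
  then show ?thesis by (simp add: permutes_inv_eq[OF snd_cut_permutes])
qed

lemma restrict_vec_act:
  assumes x: "x \<in> carrier (Lpow n)"
  shows "restrict (vec_act n g x) {..<m} = vec_act m (cut m g) (restrict x {..<m})"
proof -
  have "Hilbert_Choice.inv (snd g) i < m" if "i < m" for i
    using snd_less_iff[of "Hilbert_Choice.inv (snd g) i"] permutes_inverses[OF perm] that by simp
  moreover have "vec_act m (cut m g) (restrict x {..<m}) = (\<lambda>i\<in>{..<m}.
      if i \<in> fst (cut m g) then conj_klein (restrict x {..<m} (Hilbert_Choice.inv (snd (cut m g)) i))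
      else restrict x {..<m} (Hilbert_Choice.inv (snd (cut m g)) i))"
    using vec_act_apply[OF restrict_carrier, of m "fst (cut m g)" "snd (cut m g)"] by simp
  moreover have "vec_act n g x = (\<lambda>i\<in>{..<n}. if i \<in> fst g then conj_klein (x (Hilbert_Choice.inv (snd g) i))
      else x (Hilbert_Choice.inv (snd g) i))"
    using vec_act_apply[OF x, of "fst g" "snd g"] by simp
  ultimately show ?thesis using mn by (auto simp: fun_eq_iff inv_cut) (auto simp: cut_def)
qed

lemma binary_from_vec_act:
  assumes x: "x \<in> carrier (Lpow n)"
  shows "binary_from n m (vec_act n g x) \<longleftrightarrow> binary_from n m x"
proof -
  have "binary_from n m (vec_act n g x) \<longleftrightarrow> (\<forall>i\<in>snd g ` {m..<n}. vec_act n g x i \<in> {L0, L1})"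
    by (simp only: binary_from_def tail)
  also have "\<dots> \<longleftrightarrow> binary_from n m x"
    using vec_act_image_apply[of "fst g" "snd g" n x] g x
    by (auto simp: binary_from_def conj_klein_eq_iff split: if_splits)
  finally show ?thesis .
qed

lemma shorten_code_act:
  assumes C: "C \<subseteq> carrier (Lpow n)"
  shows "shorten n m (code_act n g C) = code_act m (cut m g) (shorten n m C)"
proof -
  have "{z \<in> code_act n g C. binary_from n m z} = vec_act n g ` {z \<in> C. binary_from n m z}"
    using C binary_from_vec_act by (auto simp: code_act_def)
  then show ?thesis
    using C restrict_vec_act by (auto simp: shorten_def code_act_def image_image intro!: image_cong)
qed

end

text \<open>A permutation of the first \<open>m\<close> coordinates is the identity on the tail, so
  the same pair is an element of the larger group.\<close>

lemma GG_lift: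
  assumes g: "g \<in> carrier (GG m)" and mn: "m \<le> n"
  shows "g \<in> carrier (GG n)" "snd g ` {m..<n} = {m..<n}" "cut m g = g"
proof -
  obtain A \<pi> where gA: "g = (A, \<pi>)" "A \<subseteq> {..<m}" and p: "\<pi> permutes {..<m}"
    using g by (auto simp: GG_def)
  have fix_: "\<pi> i = i" if "\<not> i < m" for i using permutes_not_in[OF p, of i] that by simp
  show "g \<in> carrier (GG n)" using gA mn permutes_subset[OF p, of "{..<n}"] by (auto simp: GG_def)
  show "snd g ` {m..<n} = {m..<n}" using fix_ by (force simp: gA)
  show "cut m g = g" using gA fix_ by (auto simp: cut_def fun_eq_iff)
qed

text \<open>Normal forms are the pairs whose copy of Delta sits on the tail. An equivalence between
  two of them preserves the tail and so restricts to the shortened codes. Conversely an equivalence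
  of shortened codes lifts, and it determines the even code above up to the conjugation at
  \<open>m\<close>.\<close>

lemma delta_pair_correspondence:
  assumes k: "1 \<le> k" "k \<le> n"
  shows "\<exists>f. bij_betw f (delta_pair_classes n k) (code_classes (n - k) {D. self_dual (n - k) D})"
proof -
  define m where "m = n - k"
  have m: "m < n" "m \<le> n" "card {m..<n} = k" using k by (auto simp: m_def)
  define E where "E = Delta_on n {m..<n}"
  have gE: "code_act n g E = E" if "g \<in> carrier (GG n)" "snd g ` {m..<n} = {m..<n}" for g
    by (simp add: E_def code_act_Delta_on that)
  define N where "N = {(C, S, E'). (C, S, E') \<in> delta_pairs n k \<and> S = {m..<n}}"
  have N: "P \<in> N \<longleftrightarrow> (\<exists>C. P = (C, {m..<n}, E) \<and> self_dual n C \<and> even_code n C \<and> E \<subseteq> C)" for P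
    using m by (auto simp: N_def delta_pairs_iff E_def)
  have "\<exists>f. bij_betw f (orbits (GG n) (delta_pairs n k) (delta_pair_act n))
      (orbits (GG m) {D. self_dual m D} (code_act m))"
  proof (rule orbits_bij_betw[OF delta_pair.invariant_action_axioms code.invariant_action_axioms])
    show "delta_pairs n k \<subseteq> Pow (carrier (Lpow n)) \<times> UNIV \<times> Pow (carrier (Lpow n))"
      using self_dual_subset by (auto simp: delta_pairs_def)
    show "{D. self_dual m D} \<subseteq> Pow (carrier (Lpow m))" using self_dual_subset by blast
    show "N \<subseteq> delta_pairs n k" by (auto simp: N_def)
    show "(\<lambda>(C, S, E). shorten n m C) ` N = {D. self_dual m D}"
    proof (intro equalityI subsetI)
      fix D assume "D \<in> {D. self_dual m D}"
      then obtain C where "self_dual n C" "even_code n C" "E \<subseteq> C" "shorten n m C = D"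
        using self_dual_is_shortened[OF _ m(1)] by (auto simp: E_def)
      then have "(C, {m..<n}, E) \<in> N" "D = (case (C, {m..<n}, E) of (C, S, E) \<Rightarrow> shorten n m C)"
        by (simp_all add: N)
      then show "D \<in> (\<lambda>(C, S, E). shorten n m C) ` N" by (rule rev_image_eqI)
    qed (use shorten_self_dual[OF m(1)] in \<open>auto simp: N E_def\<close>)
    show "\<exists>g\<in>carrier (GG n). delta_pair_act n g P \<in> N" if "P \<in> delta_pairs n k" for P
    proof -
      obtain C S E' where P: "P = (C, S, E')" by (cases P) auto
      have "S \<subseteq> {..<n}" "card S = card {m..<n}" using that m by (auto simp: P delta_pairs_iff)
      moreover have "{m..<n} \<subseteq> {..<n}" by auto
      ultimately obtain \<pi> where \<pi>: "\<pi> permutes {..<n}" "\<pi> ` S = {m..<n}"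
        using permutes_moving_subset[of "{..<n}" S "{m..<n}"] by blast
      have g: "({}, \<pi>) \<in> carrier (GG n)" using \<pi> by (simp add: GG_def)
      have "delta_pair_act n ({}, \<pi>) P \<in> N"
        using delta_pairs_closed[OF that[unfolded P] g] \<pi>(2) by (simp add: N_def P delta_pair_act_def)
      with g show ?thesis by blast
    qed
    show "(\<exists>g\<in>carrier (GG n). P' = delta_pair_act n g P) \<longleftrightarrow>
        (\<exists>h\<in>carrier (GG m). (case P' of (C, S, E) \<Rightarrow> shorten n m C) =
          code_act m h (case P of (C, S, E) \<Rightarrow> shorten n m C))"
      if PN: "P \<in> N" "P' \<in> N" for P P'
    proof -
      obtain C where P: "P = (C, {m..<n}, E)" and C: "self_dual n C" "even_code n C" "E \<subseteq> C"
        using PN(1) N by blast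
      obtain C' where P': "P' = (C', {m..<n}, E)" and C': "self_dual n C'" "even_code n C'" "E \<subseteq> C'"
        using PN(2) N by blast
      show ?thesis
      proof
        assume "\<exists>g\<in>carrier (GG n). P' = delta_pair_act n g P"
        then obtain g where g: "g \<in> carrier (GG n)" "snd g ` {m..<n} = {m..<n}" "C' = code_act n g C"
          by (auto simp: P P' delta_pair_act_def)
        then have "shorten n m C' = code_act m (cut m g) (shorten n m C)"
          using shorten_code_act[OF m(2) g(1,2) self_dual_subset[OF C(1)]] by simp
        then show "\<exists>h\<in>carrier (GG m). (case P' of (C, S, E) \<Rightarrow> shorten n m C) =
            code_act m h (case P of (C, S, E) \<Rightarrow> shorten n m C)"
          using cut_closed[OF m(2) g(1,2)] by (auto simp: P P')
      next
        assume "\<exists>h\<in>carrier (GG m). (case P' of (C, S, E) \<Rightarrow> shorten n m C) =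
            code_act m h (case P of (C, S, E) \<Rightarrow> shorten n m C)"
        then obtain h where h: "h \<in> carrier (GG m)" "shorten n m C' = code_act m h (shorten n m C)"
          by (auto simp: P P')
        note hn = GG_lift[OF h(1) m(2)]
        \<comment> \<open>The conjugation at \<open>m\<close> fixes the tail and \<open>E\<close>;
          it corrects the lift of \<open>h\<close> when this reaches the wrong one of the two even
          codes over the same shortened code.\<close>
        let ?r = "({m}, id) :: nat set \<times> (nat \<Rightarrow> nat)"
        have r: "?r \<in> carrier (GG n)" "snd ?r ` {m..<n} = {m..<n}"
          using m by (simp_all add: GG_def permutes_id)
        have hC: "self_dual n (code_act n h C)" "even_code n (code_act n h C)"
          using C by (simp_all add: code_act_self_dual[OF hn(1)] code_act_even[OF hn(1) self_dual_subset])
        have "code_act n h E \<subseteq> code_act n h C" using C(3) unfolding code_act_def by (rule image_mono)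
        then have hE: "E \<subseteq> code_act n h C" by (simp only: gE[OF hn(1,2)])
        have "shorten n m (code_act n h C) = shorten n m C'"
          using shorten_code_act[OF m(2) hn(1,2) self_dual_subset[OF C(1)]] hn(3) h(2) by simp
        then have "C' = code_act n h C \<or> C' = code_act n ?r (code_act n h C)"
          using shorten_eq_cases[OF m(1) hC(1,2) _ C'(1,2)] hE C'(3) by (simp add: E_def)
        then have "P' = delta_pair_act n h P \<or> P' = delta_pair_act n ?r (delta_pair_act n h P)"
          using gE[OF hn(1,2)] gE[OF r] hn(2) by (auto simp: P P' delta_pair_act_def)
        moreover have "P \<in> Pow (carrier (Lpow n)) \<times> UNIV \<times> Pow (carrier (Lpow n))"
          using C self_dual_subset[OF C(1)] by (auto simp: P)
        then have "delta_pair_act n ?r (delta_pair_act n h P) = delta_pair_act n (?r \<otimes>\<^bsub>GG n\<^esub> h) P"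
          using delta_pair.act_mult[OF r(1) hn(1)] by simp
        ultimately show "\<exists>g\<in>carrier (GG n). P' = delta_pair_act n g P"
          using hn(1) r(1) code.m_closed[OF r(1) hn(1)] by metis
      qed
    qed
  qed
  then show ?thesis by (simp add: delta_pair_classes_def code_classes_def m_def)
qed

text \<open>The bound \<open>k \<le> n\<close> keeps \<open>n - k\<close> from being truncated: for
  \<open>k > n\<close> there are no pairs, while length 0 does carry a self-dual code.\<close>

theorem theorem4p8:
  shows
  "(\<forall>n k. 1 \<le> k \<and> k \<le> n \<longrightarrow>
      (\<exists>f. bij_betw f (delta_pair_classes n k) (code_classes (n - k) {D. self_dual (n - k) D})))
   \<and>
   (\<forall>n.
      (\<forall>(C, X) \<in> coset_pairs n.
         (\<forall>x\<in>X. \<forall>x'\<in>X. C \<inter> perp n x = C \<inter> perp n x') \<and>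
         (\<exists>y\<in>X. odd (ewt n y)) \<and>
         (\<forall>x\<in>X. \<forall>y\<in>X. odd (ewt n y) \<longrightarrow>
            self_dual n (D_code n C x y) \<and> \<not> even_code n (D_code n C x y)) \<and>
         (\<forall>x\<in>X. \<forall>x'\<in>X. \<forall>y\<in>X. \<forall>y'\<in>X. odd (ewt n y) \<and> odd (ewt n y') \<longrightarrow>
            D_code n C x y = D_code n C x' y')) \<and>
      (\<exists>\<Phi>. \<Phi> \<in> coset_pair_classes n \<rightarrow> code_classes n {D. self_dual n D \<and> \<not> even_code n D} \<and>
         (\<forall>(C, X) \<in> coset_pairs n. \<forall>x\<in>X. \<forall>y\<in>X. odd (ewt n y) \<longrightarrow>
            \<Phi> (orbit (GG n) (coset_pair_act n) (C, X)) = orbit (GG n) (code_act n) (D_code n C x y)) \<and>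
         (\<forall>Q \<in> code_classes n {D. self_dual n D \<and> \<not> even_code n D}.
            card {P \<in> coset_pair_classes n. \<Phi> P = Q} \<in> {1, 2})))"
proof (intro conjI allI impI)
  show "\<exists>f. bij_betw f (delta_pair_classes n k) (code_classes (n - k) {D. self_dual (n - k) D})"
    if "1 \<le> k \<and> k \<le> n" for n k
    using that delta_pair_correspondence by blast
next
  fix n
  show "\<forall>(C, X) \<in> coset_pairs n.
      (\<forall>x\<in>X. \<forall>x'\<in>X. C \<inter> perp n x = C \<inter> perp n x') \<and>
      (\<exists>y\<in>X. odd (ewt n y)) \<and>
      (\<forall>x\<in>X. \<forall>y\<in>X. odd (ewt n y) \<longrightarrow>
        self_dual n (D_code n C x y) \<and> \<not> even_code n (D_code n C x y)) \<and>
      (\<forall>x\<in>X. \<forall>x'\<in>X. \<forall>y\<in>X. \<forall>y'\<in>X. odd (ewt n y) \<and> odd (ewt n y') \<longrightarrow>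
        D_code n C x y = D_code n C x' y')"
  proof (rule ballI, rule case_prodI2, intro conjI)
    fix P C X assume "P \<in> coset_pairs n" "P = (C, X)"
    then have CX: "(C, X) \<in> coset_pairs n" by simp
    show "\<forall>x\<in>X. \<forall>x'\<in>X. C \<inter> perp n x = C \<inter> perp n x'"
      using coset_pair_orthogonal_eq[OF CX] by blast
    show "\<exists>y\<in>X. odd (ewt n y)" by (rule coset_pair_odd[OF CX])
    show "\<forall>x\<in>X. \<forall>y\<in>X. odd (ewt n y) \<longrightarrow>
        self_dual n (D_code n C x y) \<and> \<not> even_code n (D_code n C x y)"
      by (simp add: D_code_eq_neighbour[OF CX] neighbour_self_dual[OF CX] neighbour_not_even[OF CX])
    show "\<forall>x\<in>X. \<forall>x'\<in>X. \<forall>y\<in>X. \<forall>y'\<in>X. odd (ewt n y) \<and> odd (ewt n y') \<longrightarrow>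
        D_code n C x y = D_code n C x' y'"
      by (simp add: D_code_eq_neighbour[OF CX])
  qed
next
  fix n
  \<comment> \<open>Taking the elementwise image of a whole class defines the map on classes without
    choosing representatives.\<close>
  let ?\<Phi> = "\<lambda>P. (\<lambda>(C, X). neighbour n C X) ` P"
  show "\<exists>\<Phi>. \<Phi> \<in> coset_pair_classes n \<rightarrow> code_classes n {D. self_dual n D \<and> \<not> even_code n D} \<and>
      (\<forall>(C, X) \<in> coset_pairs n. \<forall>x\<in>X. \<forall>y\<in>X. odd (ewt n y) \<longrightarrow>
        \<Phi> (orbit (GG n) (coset_pair_act n) (C, X)) = orbit (GG n) (code_act n) (D_code n C x y)) \<and>
      (\<forall>Q \<in> code_classes n {D. self_dual n D \<and> \<not> even_code n D}.
        card {P \<in> coset_pair_classes n. \<Phi> P = Q} \<in> {1, 2})"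
  proof (intro exI[of _ ?\<Phi>] conjI)
    show "?\<Phi> \<in> coset_pair_classes n \<rightarrow> code_classes n {D. self_dual n D \<and> \<not> even_code n D}"
    proof
      fix P assume "P \<in> coset_pair_classes n"
      then obtain C X where CX: "(C, X) \<in> coset_pairs n" "P = orbit (GG n) (coset_pair_act n) (C, X)"
        by (auto simp: coset_pair_classes_def orbits_def)
      then have "?\<Phi> P = orbit (GG n) (code_act n) (neighbour n C X)"
        using image_neighbour_orbit by blast
      then show "?\<Phi> P \<in> code_classes n {D. self_dual n D \<and> \<not> even_code n D}"
        using neighbour_self_dual[OF CX(1)] neighbour_not_even[OF CX(1)]
        unfolding code_classes_def orbits_def by blast
    qed
    show "\<forall>(C, X) \<in> coset_pairs n. \<forall>x\<in>X. \<forall>y\<in>X. odd (ewt n y) \<longrightarrow>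
        ?\<Phi> (orbit (GG n) (coset_pair_act n) (C, X)) = orbit (GG n) (code_act n) (D_code n C x y)"
      using image_neighbour_orbit D_code_eq_neighbour by fastforce
    show "\<forall>Q \<in> code_classes n {D. self_dual n D \<and> \<not> even_code n D}.
        card {P \<in> coset_pair_classes n. ?\<Phi> P = Q} \<in> {1, 2}"
      using card_neighbour_fibre by blast
  qed
qed

end
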